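(* Fix $0<p<1$ and let $b=1/(1-p)$. Suppose $t=t(n)$ is a positive-integer-valued function with $t(n)\sim \tau\log_b n$ as $n\to\infty$ for some constant $\tau>0$, and let $\kappa$ be the unique positive real satisfying $\iota(\tau,\kappa)=0$. Then asymptotically almost surely \[ \chi_t(G(n,p))\sim \frac{n}{\kappa\log_b n}. \]
   Context: $G(n,p)$ is the Erdős–Rényi random graph on vertex set $[n]=\{1,\dots,n\}$ with each edge present independently with probability $p$. For a positive integer $t$, a $t$-component set of a graph $G$ is a vertex subset inducing a subgraph all of whose connected components have at most $t$ vertices. The $t$-component chromatic number $\chi_t(G)$ is the least number of colours in a vertex colouring of $G$ (not necessarily proper) in which every colour class is a $t$-component set. For $\tau,\kappa>0$, \[ \iota(\tau,\kappa)=\frac12\left(\left(\kappa-\tau\left\lfloor\tfrac{\kappa}{\tau}\right\rfloor\right)\left(\kappa-\tau\left\lfloor\tfrac{\kappa}{\tau}\right\rfloor-\tau\right)-\kappa(\kappa-\tau-2)\right). \] A property holds asymptotically almost surely (a.a.s.) if its probability tends to $1$ as $n\to\infty$. *)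

theory Defs
  imports "HOL-Probability.Probability" "HOL-Library.Landau_Symbols"
begin

text \<open>A simple graph is a vertex set together with a set of two-element subsets of it.\<close>

type_synonym 'a sgraph = "'a set \<times> 'a set set"

abbreviation sverts :: "'a sgraph \<Rightarrow> 'a set" where
  "sverts G \<equiv> fst G"

abbreviation sedges :: "'a sgraph \<Rightarrow> 'a set set" where
  "sedges G \<equiv> snd G"

definition induced_sgraph :: "'a sgraph \<Rightarrow> 'a set \<Rightarrow> 'a sgraph" where
  "induced_sgraph G S = (sverts G \<inter> S, {e \<in> sedges G. e \<subseteq> S})"

definition sadj :: "'a sgraph \<Rightarrow> ('a \<times> 'a) set" where
  "sadj G = {(u, v). u \<in> sverts G \<and> v \<in> sverts G \<and> {u, v} \<in> sedges G}"

definition connected_components :: "'a sgraph \<Rightarrow> 'a set set" where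
  "connected_components G = (\<lambda>v. {u \<in> sverts G. (v, u) \<in> (sadj G)\<^sup>*}) ` sverts G"

definition t_component_set :: "nat \<Rightarrow> 'a sgraph \<Rightarrow> 'a set \<Rightarrow> bool" where
  "t_component_set t G S \<longleftrightarrow> S \<subseteq> sverts G \<and>
     (\<forall>C \<in> connected_components (induced_sgraph G S). finite C \<and> card C \<le> t)"

definition t_component_colouring :: "nat \<Rightarrow> 'a sgraph \<Rightarrow> nat \<Rightarrow> ('a \<Rightarrow> nat) \<Rightarrow> bool" where
  "t_component_colouring t G k c \<longleftrightarrow> c ` sverts G \<subseteq> {..<k} \<and>
     (\<forall>i < k. t_component_set t G {v \<in> sverts G. c v = i})"

definition t_component_chromatic_number :: "nat \<Rightarrow> 'a sgraph \<Rightarrow> nat" where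
  "t_component_chromatic_number t G = (LEAST k. \<exists>c. t_component_colouring t G k c)"

definition potential_edges :: "nat \<Rightarrow> nat set set" where
  "potential_edges n = {e. e \<subseteq> {1..n} \<and> card e = 2}"

text \<open>The default value \<open>False\<close> of the product concerns only sets that are not potential edges.\<close>

definition erdos_renyi :: "nat \<Rightarrow> real \<Rightarrow> nat sgraph pmf" where
  "erdos_renyi n p =
     map_pmf (\<lambda>f. ({1..n}, {e \<in> potential_edges n. f e}))
       (Pi_pmf (potential_edges n) False (\<lambda>_. bernoulli_pmf p))"

definition aas :: "(nat \<Rightarrow> 'a pmf) \<Rightarrow> (nat \<Rightarrow> 'a \<Rightarrow> bool) \<Rightarrow> bool" where
  "aas X P \<longleftrightarrow> (\<lambda>n. measure_pmf.prob (X n) {x. P n x}) \<longlonglongrightarrow> 1"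

text \<open>The usual meaning of \<open>Y(X\<^sub>n) \<sim> g(n)\<close> a.a.s.: for every fixed relative error
  \<open>\<epsilon> > 0\<close>, a.a.s. \<open>Y(X\<^sub>n)\<close> lies within a factor \<open>1 \<plusminus> \<epsilon>\<close> of \<open>g(n)\<close>.\<close>

definition aas_asymp_equiv :: "(nat \<Rightarrow> 'a pmf) \<Rightarrow> (nat \<Rightarrow> 'a \<Rightarrow> real) \<Rightarrow> (nat \<Rightarrow> real) \<Rightarrow> bool" where
  "aas_asymp_equiv X Y g \<longleftrightarrow>
     (\<forall>\<epsilon> > 0. aas X (\<lambda>n x. \<bar>Y n x - g n\<bar> \<le> \<epsilon> * \<bar>g n\<bar>))"

definition iota :: "real \<Rightarrow> real \<Rightarrow> real" where
  "iota \<tau> \<kappa> = 1/2 * ((\<kappa> - \<tau> * \<lfloor>\<kappa> / \<tau>\<rfloor>) * (\<kappa> - \<tau> * \<lfloor>\<kappa> / \<tau>\<rfloor> - \<tau>) - \<kappa> * (\<kappa> - \<tau> - 2))"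

end

theory Submission
  imports Defs "HOL-Real_Asymp.Real_Asymp"
begin

text \<open>
  Write \<open>L = log\<^sub>b n\<close>. A \<open>t\<close>-component set of size \<open>x L\<close> splits into parts of size at most
  \<open>\<tau> L\<close> with no edges between them, so it forces at least \<open>f(x) L\<^sup>2\<close> non-edges, where the convex
  piecewise linear function \<open>f(x) = max\<^sub>j (j \<tau> x - \<tau>\<^sup>2 j (j + 1) / 2)\<close> is attained by parts of size
  \<open>\<tau> L\<close> and one remainder. Since \<open>\<iota>(\<tau>, x) = x - f(x)\<close>, the root \<open>\<kappa>\<close> is the threshold of the first
  moment: for \<open>x > \<kappa>\<close> a union bound over sets and their partitions excludes such sets, which
  bounds \<open>\<chi>\<^sub>t\<close> from below.

  For \<open>x < \<kappa>\<close> the extremal complete multipartite pattern is balanced, so Janson's inequality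
  makes the probability that a fixed set of about \<open>n / L\<^sup>2\<close> vertices misses it smaller than
  \<open>exp (- n\<^sup>1\<^sup>+\<^sup>\<delta>)\<close>. This beats the \<open>2\<^sup>n\<close> choices of the set, and greedily removing
  \<open>t\<close>-component sets of size \<open>x L\<close> yields the colouring.
\<close>

section \<open>Random subsets of a finite set\<close>

text \<open>The obstacle is the variance term in Janson's inequality. Two copies of the pattern that
  agree on an index set \<open>J\<close> contribute, relative to the squared mean, about
  \<open>b ^ e / w ^ card J\<close>, where \<open>e\<close> is the number of pattern edges inside
  \<open>J\<close> and \<open>w\<close> is \<open>n\<close> up to logarithms. Hence every
  sub-pattern needs at most \<open>\<rho> L\<close> edges per vertex, for a fixed
  \<open>\<rho> < 1\<close>. Only two sub-patterns can be extremal: the full blocks alone, which are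
  fine because \<open>(m - 1) \<tau> < 2\<close>, and the whole pattern, which is fine because
  \<open>x < \<kappa>\<close>. This is why the piece \<open>m = \<lceil>2 / \<tau>\<rceil>\<close>
  of \<open>f\<close> that contains \<open>\<kappa>\<close> is tracked throughout.

  For small \<open>J\<close> the saving \<open>1 - \<rho>\<close> per vertex is too weak, but there
  the trivial bound on the number of pairs suffices. The two regimes together give
  \<open>n powr (- 4 / 3)\<close>; an exponent below \<open>- 1\<close> is what defeats
  \<open>2 ^ n\<close>. The lower bound on the chromatic number needs a single line of the maximum
  defining \<open>f\<close>, again the one with \<open>j = m\<close>.

  Probabilities are written as finite weighted sums over sets of non-edges, so that conditioning on
  one pair is plain algebra and induction on the ground set is available.\<close>

definition rset_exp :: "'a set \<Rightarrow> real \<Rightarrow> ('a set \<Rightarrow> real) \<Rightarrow> real" where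
  "rset_exp E q f = (\<Sum>R\<in>Pow E. q ^ card R * (1 - q) ^ card (E - R) * f R)"

lemma rset_exp_cong:
  assumes "\<And>R. R \<subseteq> E \<Longrightarrow> f R = g R"
  shows "rset_exp E q f = rset_exp E q g"
  unfolding rset_exp_def using assms by (intro sum.cong) auto

lemma rset_exp_mono:
  assumes "0 \<le> q" "q \<le> 1" "\<And>R. R \<subseteq> E \<Longrightarrow> f R \<le> g R"
  shows "rset_exp E q f \<le> rset_exp E q g"
  unfolding rset_exp_def using assms by (intro sum_mono mult_left_mono) auto

lemma rset_exp_nonneg:
  assumes "0 \<le> q" "q \<le> 1" "\<And>R. R \<subseteq> E \<Longrightarrow> 0 \<le> f R"
  shows "0 \<le> rset_exp E q f"
  unfolding rset_exp_def using assms by (intro sum_nonneg) auto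

lemma rset_exp_add: "rset_exp E q (\<lambda>R. f R + g R) = rset_exp E q f + rset_exp E q g"
  by (simp add: rset_exp_def algebra_simps sum.distrib)

lemma rset_exp_cmult: "rset_exp E q (\<lambda>R. c * f R) = c * rset_exp E q f"
  by (simp add: rset_exp_def sum_distrib_left mult_ac)

lemma rset_exp_sum: "rset_exp E q (\<lambda>R. \<Sum>i\<in>I. f i R) = (\<Sum>i\<in>I. rset_exp E q (f i))"
  unfolding rset_exp_def by (simp add: sum_distrib_left sum.swap[of _ _ I])

lemma rset_exp_empty [simp]: "rset_exp {} q f = f {}"
  by (simp add: rset_exp_def)

lemma rset_exp_insert:
  assumes "finite E" "x \<notin> E"
  shows "rset_exp (insert x E) q f =
    q * rset_exp E q (\<lambda>R. f (insert x R)) + (1 - q) * rset_exp E q f"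
proof -
  have inj: "inj_on (insert x) (Pow E)"
    using assms by (auto simp: inj_on_def)
  have disj: "Pow E \<inter> insert x ` Pow E = {}"
    using assms by auto
  have A: "(\<Sum>R\<in>insert x ` Pow E. q ^ card R * (1 - q) ^ card (insert x E - R) * f R)
      = q * rset_exp E q (\<lambda>R. f (insert x R))"
    unfolding rset_exp_def sum_distrib_left sum.reindex[OF inj] o_def
  proof (intro sum.cong refl)
    fix R assume R: "R \<in> Pow E"
    hence fR: "finite R" "x \<notin> R" using assms finite_subset by auto
    have "insert x E - insert x R = E - R" using assms by auto
    thus "q ^ card (insert x R) * (1 - q) ^ card (insert x E - insert x R) * f (insert x R)
      = q * (q ^ card R * (1 - q) ^ card (E - R) * f (insert x R))"
      using fR by simp
  qed
  have B: "(\<Sum>R\<in>Pow E. q ^ card R * (1 - q) ^ card (insert x E - R) * f R)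
      = (1 - q) * rset_exp E q f"
    unfolding rset_exp_def sum_distrib_left
  proof (intro sum.cong refl)
    fix R assume R: "R \<in> Pow E"
    have "insert x E - R = insert x (E - R)" using R assms by auto
    thus "q ^ card R * (1 - q) ^ card (insert x E - R) * f R
      = (1 - q) * (q ^ card R * (1 - q) ^ card (E - R) * f R)"
      using assms by simp
  qed
  show ?thesis
    unfolding rset_exp_def[of "insert x E"] Pow_insert
    using A B assms disj by (subst sum.union_disjoint) auto
qed

lemma rset_exp_const [simp]: "finite E \<Longrightarrow> rset_exp E q (\<lambda>_. c) = c"
  by (induction E rule: finite_induct) (simp_all add: rset_exp_insert algebra_simps)

lemma rset_exp_complement:
  "finite E \<Longrightarrow> rset_exp E (1 - q) (\<lambda>R. f (E - R)) = rset_exp E q f"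
  unfolding rset_exp_def
  by (rule sum.reindex_bij_witness[of _ "\<lambda>R. E - R" "\<lambda>R. E - R"]) (auto simp: double_diff)

text \<open>Conditioning on \<open>S \<subseteq> R\<close> amounts to forcing \<open>S\<close> into
  the random set, because the remaining elements are independent of it. Writing
  \<open>R \<union> S\<close> keeps both sides over the same ground set \<open>E\<close>, which is
  what Janson's argument needs.\<close>

lemma rset_exp_superset:
  assumes "finite E" "S \<subseteq> E"
  shows "rset_exp E q (\<lambda>R. if S \<subseteq> R then f R else 0) = q ^ card S * rset_exp E q (\<lambda>R. f (R \<union> S))"
proof -
  have step: "rset_exp E q (\<lambda>R. if x \<in> R then g R else 0) = q * rset_exp E q (\<lambda>R. g (insert x R))"
    if "x \<in> E" for x g
  proof -
    define E' where "E' = E - {x}"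
    have E: "E = insert x E'" "x \<notin> E'" "finite E'" using that assms by (auto simp: E'_def)
    have "rset_exp E' q (\<lambda>R. if x \<in> R then g R else 0) = rset_exp E' q (\<lambda>_. 0)"
      using E by (intro rset_exp_cong) auto
    thus ?thesis
      unfolding E(1) using E(2,3) by (simp add: rset_exp_insert algebra_simps)
  qed
  from finite_subset[OF assms(2,1)] assms(2) show ?thesis
  proof (induction S arbitrary: f rule: finite_induct)
    case empty
    thus ?case by simp
  next
    case (insert x S)
    have "rset_exp E q (\<lambda>R. if insert x S \<subseteq> R then f R else 0)
        = rset_exp E q (\<lambda>R. if x \<in> R then (if S \<subseteq> R then f R else 0) else 0)"
      by (intro rset_exp_cong) auto
    also have "\<dots> = q * rset_exp E q (\<lambda>R. if S \<subseteq> insert x R then f (insert x R) else 0)"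
      using insert by (subst step) auto
    also have "rset_exp E q (\<lambda>R. if S \<subseteq> insert x R then f (insert x R) else 0)
        = rset_exp E q (\<lambda>R. if S \<subseteq> R then f (insert x R) else 0)"
      using insert by (intro rset_exp_cong) auto
    finally show ?case using insert by (simp add: insert.IH)
  qed
qed

lemma rset_exp_indicator_superset:
  assumes "finite E" "S \<subseteq> E"
  shows "rset_exp E q (\<lambda>R. if S \<subseteq> R then 1 else 0) = q ^ card S"
  using rset_exp_superset[OF assms, of q "\<lambda>_. 1"] assms by simp

lemma rset_exp_union_bound:
  assumes "finite E" "0 \<le> q" "q \<le> 1" "finite I"
  shows "rset_exp E q (\<lambda>R. if \<exists>i\<in>I. P i R then 1 else 0)
    \<le> (\<Sum>i\<in>I. rset_exp E q (\<lambda>R. if P i R then 1 else 0))"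
proof -
  have "(if \<exists>i\<in>I. P i R then 1 else 0) \<le> (\<Sum>i\<in>I. if P i R then 1 else (0::real))" for R
  proof (cases "\<exists>i\<in>I. P i R")
    case True
    then obtain i where i: "i \<in> I" "P i R" by auto
    have "(\<Sum>i\<in>{i}. if P i R then 1 else (0::real)) \<le> (\<Sum>i\<in>I. if P i R then 1 else 0)"
      using i assms by (intro sum_mono2) auto
    thus ?thesis using i by auto
  qed (auto intro: sum_nonneg)
  thus ?thesis
    unfolding rset_exp_sum[symmetric] using assms by (intro rset_exp_mono) auto
qed

text \<open>The bridge from the product measure to finite sums. Since \<open>h\<close> sees only
  \<open>{e \<in> E. f e}\<close>, the default value outside \<open>E\<close> has no influence, and
  the induction conditions on one coordinate.\<close>

lemma expectation_Pi_bernoulli: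
  fixes h :: "'a set \<Rightarrow> real"
  assumes "finite E" "0 \<le> p" "p \<le> 1"
  shows "measure_pmf.expectation (Pi_pmf E False (\<lambda>_. bernoulli_pmf p)) (\<lambda>f. h {e \<in> E. f e}) = rset_exp E p h"
  using assms(1)
proof (induction E arbitrary: h rule: finite_induct)
  case empty
  thus ?case by simp
next
  case (insert x E)
  let ?P = "Pi_pmf E False (\<lambda>_. bernoulli_pmf p)"
  have fin: "finite (set_pmf ?P)"
    using insert.hyps by (subst set_Pi_pmf) (auto intro!: finite_PiE_dflt simp: finite_subset[OF subset_UNIV])
  have "measure_pmf.expectation (Pi_pmf (insert x E) False (\<lambda>_. bernoulli_pmf p)) (\<lambda>f. h {e \<in> insert x E. f e})
      = (\<Sum>y\<in>UNIV. pmf (bernoulli_pmf p) y * measure_pmf.expectation (map_pmf (\<lambda>f. f(x := y)) ?P) (\<lambda>f. h {e \<in> insert x E. f e}))"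
    unfolding Pi_pmf_insert'[OF insert.hyps] map_pmf_def[symmetric]
    using fin by (subst pmf_expectation_bind[of UNIV]) auto
  also have "\<dots> = p * measure_pmf.expectation ?P (\<lambda>f. h (insert x {e \<in> E. f e}))
      + (1 - p) * measure_pmf.expectation ?P (\<lambda>f. h {e \<in> E. f e})"
  proof -
    have "{e \<in> insert x E. (f(x := True)) e} = insert x {e \<in> E. f e}"
      "{e \<in> insert x E. (f(x := False)) e} = {e \<in> E. f e}" for f
      using insert.hyps by auto
    thus ?thesis using assms by (simp add: UNIV_bool)
  qed
  finally show ?case
    unfolding insert.IH insert.IH[of "\<lambda>R. h (insert x R)"] rset_exp_insert[OF insert.hyps] .
qed

lemma finite_potential_edges [simp]: "finite (potential_edges n)"
  unfolding potential_edges_def by simp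

text \<open>The random set on the right is the set of non-edges.\<close>

lemma prob_erdos_renyi:
  assumes "0 \<le> p" "p \<le> 1"
  shows "measure_pmf.prob (erdos_renyi n p) {G. P G}
    = rset_exp (potential_edges n) (1 - p) (\<lambda>R. if P ({1..n}, potential_edges n - R) then 1 else 0)"
proof -
  have "measure_pmf.prob (erdos_renyi n p) {G. P G}
      = measure_pmf.expectation (erdos_renyi n p) (\<lambda>G. indicator {G. P G} G)"
    by simp
  also have "\<dots> = rset_exp (potential_edges n) p (\<lambda>R. indicator {G. P G} ({1..n}, R))"
    unfolding erdos_renyi_def integral_map_pmf
    using assms by (subst expectation_Pi_bernoulli[symmetric]) auto
  also have "\<dots> = rset_exp (potential_edges n) (1 - p) (\<lambda>R. indicator {G. P G} ({1..n}, potential_edges n - R))"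
    by (subst rset_exp_complement[symmetric]) auto
  finally show ?thesis by (simp add: indicator_def of_bool_def)
qed

text \<open>Condition on one element: the induction hypothesis handles the two conditional
  expectations, and two decreasing functions of one Bernoulli variable are positively correlated.
  Monotonicity is assumed for all sets, so that it passes to
  \<open>\<lambda>R. f (insert x R)\<close>. The decreasing form fits the functions
  \<open>exp (- s * Y)\<close> used below.\<close>

theorem harris_inequality:
  assumes "finite E" and q: "0 \<le> q" "q \<le> 1"
    and "\<And>A B. A \<subseteq> B \<Longrightarrow> f B \<le> f A" "\<And>A B. A \<subseteq> B \<Longrightarrow> g B \<le> g A"
  shows "rset_exp E q f * rset_exp E q g \<le> rset_exp E q (\<lambda>R. f R * g R)"
  using assms(1,4,5)
proof (induction E arbitrary: f g rule: finite_induct)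
  case empty
  thus ?case by simp
next
  case (insert x E)
  let ?f1 = "\<lambda>R. f (insert x R)" and ?g1 = "\<lambda>R. g (insert x R)"
  let ?F1 = "rset_exp E q ?f1" and ?F0 = "rset_exp E q f"
  let ?G1 = "rset_exp E q ?g1" and ?G0 = "rset_exp E q g"
  have mono: "?f1 B \<le> ?f1 A" "?g1 B \<le> ?g1 A" if "A \<subseteq> B" for A B
    using Set.insert_mono[OF that, of x] by (auto intro!: insert.prems)
  have "?F1 \<le> ?F0" "?G1 \<le> ?G0"
    using q by (auto intro!: rset_exp_mono insert.prems)
  \<comment> \<open>This product is exactly the covariance of the two conditional means, viewed as
    functions of the indicator of \<open>x\<close>.\<close>
  hence "0 \<le> q * (1 - q) * ((?F0 - ?F1) * (?G0 - ?G1))"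
    using q by auto
  hence "(q * ?F1 + (1 - q) * ?F0) * (q * ?G1 + (1 - q) * ?G0)
      \<le> q * (?F1 * ?G1) + (1 - q) * (?F0 * ?G0)"
    by (simp add: algebra_simps)
  also have "\<dots> \<le> q * rset_exp E q (\<lambda>R. ?f1 R * ?g1 R) + (1 - q) * rset_exp E q (\<lambda>R. f R * g R)"
    using insert.IH[OF mono] insert.IH[OF insert.prems] q
    by (intro add_mono mult_left_mono) auto
  finally show ?case using insert.hyps by (simp add: rset_exp_insert)
qed

text \<open>Janson's Laplace transform argument: Harris' inequality gives
  \<open>- \<Psi>'(s) \<ge> (\<mu> - s \<Delta>) \<Psi>(s)\<close> for \<open>\<Psi>(s) = E exp (- s X)\<close>; integrate up to \<open>s = \<mu> / \<Delta>\<close>.\<close>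

theorem janson_inequality:
  fixes S :: "'i \<Rightarrow> 'a set"
  assumes E: "finite E" and q: "0 \<le> q" "q \<le> 1" and I: "finite I"
    and S: "\<And>i. i \<in> I \<Longrightarrow> S i \<subseteq> E" and "0 < \<Delta>"
    and \<Delta>: "(\<Sum>i\<in>I. \<Sum>j\<in>I. if S i \<inter> S j = {} then 0 else q ^ card (S i \<union> S j)) \<le> \<Delta>"
  shows "rset_exp E q (\<lambda>R. if \<exists>i\<in>I. S i \<subseteq> R then 0 else 1)
    \<le> exp (- (\<Sum>i\<in>I. q ^ card (S i))\<^sup>2 / (2 * \<Delta>))"
proof -
  define \<mu> where "\<mu> = (\<Sum>i\<in>I. q ^ card (S i))"
  define ind :: "'i \<Rightarrow> 'a set \<Rightarrow> real" where "ind i R = (if S i \<subseteq> R then 1 else 0)" for i R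
  define X where "X R = (\<Sum>i\<in>I. ind i R)" for R
  \<comment> \<open>\<open>Y i\<close> counts the patterns meeting \<open>S i\<close>, including
    \<open>i\<close> itself when \<open>S i\<close> is nonempty. The bound \<open>\<Delta>\<close>
    therefore contains the diagonal terms, which gives the exponent
    \<open>\<mu>\<^sup>2 / (2 * \<Delta>)\<close>.\<close>
  define Y where "Y i R = (\<Sum>j\<in>{j\<in>I. S i \<inter> S j \<noteq> {}}. ind j R)" for i R
  define Z where "Z i R = (\<Sum>j\<in>{j\<in>I. S i \<inter> S j = {}}. ind j R)" for i R
  define \<Psi> where "\<Psi> s = rset_exp E q (\<lambda>R. exp (- s * X R))" for s
  define \<Psi>' where "\<Psi>' s = rset_exp E q (\<lambda>R. - X R * exp (- s * X R))" for s
  have ind_mono: "ind j A \<le> ind j B" if "A \<subseteq> B" for j A B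
    using that by (auto simp: ind_def)
  have ind_nn: "0 \<le> ind j A" for j A by (auto simp: ind_def)
  have X_split: "X R = Y i R + Z i R" for i R
    unfolding X_def Y_def Z_def using I
    by (subst sum.union_disjoint[symmetric]) (auto intro: sum.cong)
  have Y_mono: "Y i A \<le> Y i B" and Z_mono: "Z i A \<le> Z i B" if "A \<subseteq> B" for i A B
    unfolding Y_def Z_def using ind_mono[OF that] by (auto intro: sum_mono)
  have Z_union: "Z i (R \<union> S i) = Z i R" for i R
    unfolding Z_def ind_def by (intro sum.cong) auto
  have \<Psi>_nn: "0 \<le> \<Psi> s" for s
    unfolding \<Psi>_def using q by (intro rset_exp_nonneg) auto
  have ind_exp_mult: "rset_exp E q (\<lambda>R. ind i R * h R) = q ^ card (S i) * rset_exp E q (\<lambda>R. h (R \<union> S i))"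
    if "i \<in> I" for i h
    using rset_exp_superset[OF E S[OF that], of q h] by (simp add: ind_def if_distrib[of "\<lambda>x. x * _"] cong: if_cong)
  have deriv: "(\<Psi> has_real_derivative \<Psi>' s) (at s)" for s
    unfolding \<Psi>_def[abs_def] \<Psi>'_def rset_exp_def
    by (auto intro!: derivative_eq_intros simp: mult_ac intro: sum.cong)
  have main: "(\<mu> - s * \<Delta>) * \<Psi> s \<le> - \<Psi>' s" if s: "0 \<le> s" for s
  proof -
    \<comment> \<open>Once \<open>S i\<close> is forced into the set, only \<open>Y i\<close>
      changes; \<open>Z i\<close> does not involve elements of \<open>S i\<close>. Harris'
      inequality separates the two factors, \<open>\<Psi> s\<close> is at most the one with
      \<open>Z i\<close>, and \<open>1 - s * Y i\<close> linearises the one with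
      \<open>Y i\<close>.\<close>
    have one: "rset_exp E q (\<lambda>R. ind i R * (1 - s * Y i R)) * \<Psi> s
        \<le> rset_exp E q (\<lambda>R. ind i R * exp (- s * X R))" if i: "i \<in> I" for i
    proof -
      have "rset_exp E q (\<lambda>R. ind i R * (1 - s * Y i R)) \<le> rset_exp E q (\<lambda>R. ind i R * exp (- s * Y i R))"
        using q ind_nn exp_ge_add_one_self[of "- s * Y i _"]
        by (intro rset_exp_mono mult_left_mono) (auto simp: algebra_simps)
      also have "\<dots> = q ^ card (S i) * rset_exp E q (\<lambda>R. exp (- s * Y i (R \<union> S i)))"
        using i by (simp add: ind_exp_mult)
      finally have 1: "rset_exp E q (\<lambda>R. ind i R * (1 - s * Y i R))
        \<le> q ^ card (S i) * rset_exp E q (\<lambda>R. exp (- s * Y i (R \<union> S i)))" .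
      have "\<Psi> s \<le> rset_exp E q (\<lambda>R. exp (- s * Z i R))"
        unfolding \<Psi>_def using q s
        by (intro rset_exp_mono) (auto simp: X_split[of _ i] Y_def intro!: mult_left_mono sum_nonneg ind_nn)
      hence "rset_exp E q (\<lambda>R. exp (- s * Y i (R \<union> S i))) * \<Psi> s
        \<le> rset_exp E q (\<lambda>R. exp (- s * Y i (R \<union> S i))) * rset_exp E q (\<lambda>R. exp (- s * Z i R))"
        using q by (intro mult_left_mono rset_exp_nonneg) auto
      also have "\<dots> \<le> rset_exp E q (\<lambda>R. exp (- s * Y i (R \<union> S i)) * exp (- s * Z i R))"
        using E q s by (intro harris_inequality) (auto intro!: mult_left_mono Y_mono Z_mono)
      also have "\<dots> = rset_exp E q (\<lambda>R. exp (- s * X (R \<union> S i)))"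
        by (simp add: X_split[of _ i] Z_union exp_add[symmetric] algebra_simps)
      finally have 2: "rset_exp E q (\<lambda>R. exp (- s * Y i (R \<union> S i))) * \<Psi> s
        \<le> rset_exp E q (\<lambda>R. exp (- s * X (R \<union> S i)))" .
      have "rset_exp E q (\<lambda>R. ind i R * (1 - s * Y i R)) * \<Psi> s
        \<le> q ^ card (S i) * rset_exp E q (\<lambda>R. exp (- s * X (R \<union> S i)))"
        using mult_right_mono[OF 1 \<Psi>_nn[of s]] mult_left_mono[OF 2, of "q ^ card (S i)"] q
        by (simp add: mult_ac)
      also have "\<dots> = rset_exp E q (\<lambda>R. ind i R * exp (- s * X R))"
        using i by (simp add: ind_exp_mult)
      finally show ?thesis .
    qed
    have ind_exp: "rset_exp E q (\<lambda>R. ind i R * (1 - s * Y i R))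
        = q ^ card (S i) - s * (\<Sum>j\<in>I. if S i \<inter> S j = {} then 0 else q ^ card (S i \<union> S j))"
      if i: "i \<in> I" for i
    proof -
      have "rset_exp E q (\<lambda>R. ind i R * (1 - s * Y i R))
        = rset_exp E q (\<lambda>R. ind i R + (- s) * (\<Sum>j\<in>{j\<in>I. S i \<inter> S j \<noteq> {}}. if S i \<union> S j \<subseteq> R then 1 else 0))"
        by (intro rset_exp_cong) (auto simp: Y_def ind_def algebra_simps intro: sum.cong)
      also have "\<dots> = q ^ card (S i) - s * (\<Sum>j\<in>{j\<in>I. S i \<inter> S j \<noteq> {}}. q ^ card (S i \<union> S j))"
      proof -
        have "rset_exp E q (\<lambda>R. if S i \<union> S j \<subseteq> R then 1 else 0) = q ^ card (S i \<union> S j)" if "j \<in> I" for j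
          using E S i that by (intro rset_exp_indicator_superset) auto
        moreover have "rset_exp E q (\<lambda>R. if S i \<subseteq> R then 1 else 0) = q ^ card (S i)"
          using E S i by (intro rset_exp_indicator_superset) auto
        ultimately show ?thesis unfolding rset_exp_add rset_exp_cmult rset_exp_sum ind_def by simp
      qed
      also have "(\<Sum>j\<in>{j\<in>I. S i \<inter> S j \<noteq> {}}. q ^ card (S i \<union> S j))
        = (\<Sum>j\<in>I. if S i \<inter> S j = {} then 0 else q ^ card (S i \<union> S j))"
        using I by (intro sum.mono_neutral_cong_left) auto
      finally show ?thesis .
    qed
    have "\<mu> - s * \<Delta> \<le> (\<Sum>i\<in>I. rset_exp E q (\<lambda>R. ind i R * (1 - s * Y i R)))"
      using mult_left_mono[OF \<Delta> s] by (simp add: ind_exp \<mu>_def sum_subtractf sum_distrib_left)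
    hence "(\<mu> - s * \<Delta>) * \<Psi> s \<le> (\<Sum>i\<in>I. rset_exp E q (\<lambda>R. ind i R * (1 - s * Y i R))) * \<Psi> s"
      using \<Psi>_nn by (intro mult_right_mono)
    also have "\<dots> \<le> (\<Sum>i\<in>I. rset_exp E q (\<lambda>R. ind i R * exp (- s * X R)))"
      unfolding sum_distrib_right by (intro sum_mono one)
    also have "\<dots> = rset_exp E q (\<lambda>R. X R * exp (- s * X R))"
      unfolding X_def rset_exp_sum[symmetric] by (simp add: sum_distrib_right)
    also have "\<dots> = - \<Psi>' s"
      unfolding \<Psi>'_def using rset_exp_cmult[of E q "-1" "\<lambda>R. X R * exp (- s * X R)"] by simp
    finally show ?thesis .
  qed
  define s where "s = \<mu> / \<Delta>"
  have "0 \<le> \<mu>" unfolding \<mu>_def using q by (intro sum_nonneg) auto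
  hence s0: "0 \<le> s" using \<open>0 < \<Delta>\<close> by (simp add: s_def)
  \<comment> \<open>Integrating factor for the differential inequality \<open>main\<close>: it makes
    \<open>G\<close> nonincreasing from \<open>G 0 = 1\<close>. The chosen \<open>s\<close>
    maximises \<open>\<mu> * s - \<Delta> * s\<^sup>2 / 2\<close>.\<close>
  define G where "G x = \<Psi> x * exp (\<mu> * x - \<Delta> * x\<^sup>2 / 2)" for x
  have "G s \<le> G 0"
  proof (rule DERIV_nonpos_imp_nonincreasing[OF s0])
    fix x assume x: "0 \<le> x" "x \<le> s"
    have "(G has_real_derivative (\<Psi>' x + (\<mu> - x * \<Delta>) * \<Psi> x) * exp (\<mu> * x - \<Delta> * x\<^sup>2 / 2)) (at x)"
      unfolding G_def[abs_def]
      by (rule derivative_eq_intros deriv refl | simp add: algebra_simps)+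
    moreover have "(\<Psi>' x + (\<mu> - x * \<Delta>) * \<Psi> x) * exp (\<mu> * x - \<Delta> * x\<^sup>2 / 2) \<le> 0"
      using main[OF x(1)] by (intro mult_nonpos_nonneg) auto
    ultimately show "\<exists>y. (G has_real_derivative y) (at x) \<and> y \<le> 0" by blast
  qed
  moreover have "G 0 = 1" using E by (simp add: G_def \<Psi>_def)
  moreover have "\<mu> * s - \<Delta> * s\<^sup>2 / 2 = \<mu>\<^sup>2 / (2 * \<Delta>)"
    using \<open>0 < \<Delta>\<close> by (simp add: s_def power2_eq_square field_simps)
  ultimately have "\<Psi> s \<le> exp (- \<mu>\<^sup>2 / (2 * \<Delta>))"
    by (simp add: G_def exp_minus field_simps)
  \<comment> \<open>When no pattern occurs, \<open>X R = 0\<close> and the integrand of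
    \<open>\<Psi> s\<close> equals 1.\<close>
  moreover have "rset_exp E q (\<lambda>R. if \<exists>i\<in>I. S i \<subseteq> R then 0 else 1) \<le> \<Psi> s"
  proof -
    have "X R = 0" if "\<not> (\<exists>i\<in>I. S i \<subseteq> R)" for R
      using that by (auto simp: X_def ind_def intro: sum.neutral)
    thus ?thesis unfolding \<Psi>_def using q by (intro rset_exp_mono) auto
  qed
  ultimately show ?thesis by (simp add: \<mu>_def)
qed

section \<open>Component sets and colourings\<close>

text \<open>A path in the induced graph cannot leave a class of \<open>c\<close>, so every component
  lies inside one class. The classes may be unions of components, so the components need not be
  known exactly.\<close>

lemma t_component_setI:
  fixes c :: "'a \<Rightarrow> 'b"
  assumes T: "T \<subseteq> sverts G" "finite T"
    and c: "\<And>u v. u \<in> T \<Longrightarrow> v \<in> T \<Longrightarrow> {u, v} \<in> sedges G \<Longrightarrow> c u = c v"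
    and card: "\<And>u. u \<in> T \<Longrightarrow> card {v \<in> T. c v = c u} \<le> t"
  shows "t_component_set t G T"
  unfolding t_component_set_def connected_components_def
proof (intro conjI ballI T)
  fix C
  assume "C \<in> (\<lambda>v. {u \<in> sverts (induced_sgraph G T). (v, u) \<in> (sadj (induced_sgraph G T))\<^sup>*})
    ` sverts (induced_sgraph G T)"
  then obtain u where u: "u \<in> T"
    and C: "C = {v \<in> sverts (induced_sgraph G T). (u, v) \<in> (sadj (induced_sgraph G T))\<^sup>*}"
    by (auto simp: induced_sgraph_def)
  have "c u = c v" if "(u, v) \<in> (sadj (induced_sgraph G T))\<^sup>*" for v
    using that by induction (auto simp: sadj_def induced_sgraph_def dest: c)
  hence sub: "C \<subseteq> {v \<in> T. c v = c u}"
    unfolding C fst_conv induced_sgraph_def by fastforce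
  show "finite C" by (rule finite_subset[OF sub]) (use T in simp)
  have "card C \<le> card {v \<in> T. c v = c u}" using sub T by (intro card_mono) auto
  thus "card C \<le> t" using card[OF u] by simp
qed

text \<open>A converse to \<open>t_component_setI\<close>, with labels taken from \<open>T\<close>
  itself. This makes the certificates countable: at most \<open>k ^ k\<close> of them for a set of
  size \<open>k\<close>.\<close>

lemma t_component_set_class_function:
  assumes "t_component_set t G T"
  shows "\<exists>c \<in> T \<rightarrow>\<^sub>E T. (\<forall>u\<in>T. \<forall>v\<in>T. {u, v} \<in> sedges G \<longrightarrow> c u = c v) \<and>
    (\<forall>u\<in>T. card {v \<in> T. c v = c u} \<le> t)"
proof -
  define A where "A = sadj (induced_sgraph G T)"
  define C where "C v = {u \<in> T. (v, u) \<in> A\<^sup>*}" for v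
  have TG: "T \<subseteq> sverts G" using assms by (auto simp: t_component_set_def)
  have card: "card (C v) \<le> t" "finite (C v)" if "v \<in> T" for v
    using assms that TG
    by (auto simp: t_component_set_def connected_components_def induced_sgraph_def C_def A_def Int_absorb1)
  have "sym A" by (auto simp: A_def sadj_def sym_def insert_commute)
  hence sym: "sym (A\<^sup>*)" by (rule sym_rtrancl)
  have CI: "v \<in> C v" if "v \<in> T" for v using that by (auto simp: C_def)
  have C_eq: "C u = C v" if "(u, v) \<in> A\<^sup>*" for u v
    using that sym by (auto simp: C_def sym_def intro: rtrancl_trans)
  \<comment> \<open>Vertices of one component have equal sets \<open>C v\<close>, hence the same
    \<open>SOME\<close> term. Restriction to \<open>T\<close> makes the function extensional, as the
    later count over \<open>T \<rightarrow>\<^sub>E T\<close> requires.\<close>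
  define c where "c = restrict (\<lambda>v. SOME u. u \<in> C v) T"
  have c: "c v \<in> C v" if "v \<in> T" for v
    using CI[OF that] that by (auto simp: c_def intro: someI)
  show ?thesis
  proof (intro bexI[of _ c] conjI ballI impI)
    show "c \<in> T \<rightarrow>\<^sub>E T"
      using c by (auto simp: c_def C_def)
    show "c u = c v" if "u \<in> T" "v \<in> T" "{u, v} \<in> sedges G" for u v
    proof -
      have "(u, v) \<in> A\<^sup>*" using that TG by (auto simp: A_def sadj_def induced_sgraph_def)
      thus ?thesis using that C_eq by (simp add: c_def)
    qed
    show "card {v \<in> T. c v = c u} \<le> t" if u: "u \<in> T" for u
    proof -
      have "v \<in> C u" if v: "v \<in> T" "c v = c u" for v
      proof -
        have "(v, c u) \<in> A\<^sup>*" "(u, c u) \<in> A\<^sup>*" using c[OF v(1)] c[OF u] v by (auto simp: C_def)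
        hence "(u, v) \<in> A\<^sup>*" using sym by (auto simp: sym_def intro: rtrancl_trans)
        thus ?thesis using v by (simp add: C_def)
      qed
      hence "card {v \<in> T. c v = c u} \<le> card (C u)"
        using card[OF u] by (intro card_mono) auto
      thus ?thesis using card[OF u] by simp
    qed
  qed
qed

lemma t_component_set_subset:
  fixes T :: "'a set"
  assumes "t_component_set t G T" "finite T" "T' \<subseteq> T"
  shows "t_component_set t G T'"
proof -
  obtain c :: "'a \<Rightarrow> 'a" where c: "\<forall>u\<in>T. \<forall>v\<in>T. {u, v} \<in> sedges G \<longrightarrow> c u = c v"
    "\<forall>u\<in>T. card {v \<in> T. c v = c u} \<le> t"
    using t_component_set_class_function[OF assms(1)] by blast
  show ?thesis
  proof (rule t_component_setI)
    show "T' \<subseteq> sverts G" using assms by (auto simp: t_component_set_def)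
    show "finite T'" using assms finite_subset by auto
    show "c u = c v" if "u \<in> T'" "v \<in> T'" "{u, v} \<in> sedges G" for u v
      using c(1) that assms(3) by auto
    show "card {v \<in> T'. c v = c u} \<le> t" if "u \<in> T'" for u
    proof -
      have "card {v \<in> T'. c v = c u} \<le> card {v \<in> T. c v = c u}"
        using assms by (intro card_mono) auto
      also have "\<dots> \<le> t" using c(2) that assms(3) by blast
      finally show ?thesis .
    qed
  qed
qed

lemma t_component_set_singleton:
  assumes "0 < t" "v \<in> sverts G"
  shows "t_component_set t G {v}"
  by (rule t_component_setI[where c = id])
    (use assms card_mono[of "{v}" "{x. x = v \<and> x = v}"] in \<open>auto simp: Collect_conv_if\<close>)

text \<open>Greedy colouring: as long as at least \<open>N\<close> vertices remain, spend a colour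
  on \<open>k\<close> of them; the fewer than \<open>N\<close> left over get one colour each.
  Multiplying by \<open>k\<close> avoids division in the count of colours.\<close>

lemma colouring_from_large_sets:
  fixes G :: "'a sgraph"
  assumes "0 < t" "0 < k" and W: "W \<subseteq> sverts G" "finite W"
    and large: "\<And>U. U \<subseteq> W \<Longrightarrow> N \<le> card U \<Longrightarrow> \<exists>T\<subseteq>U. card T = k \<and> t_component_set t G T"
  shows "\<exists>j c. c ` W \<subseteq> {..<j} \<and> (\<forall>i<j. t_component_set t G {v \<in> W. c v = i})
    \<and> k * j \<le> card W + k * N"
  using W(2) W(1) large
proof (induction W rule: finite_psubset_induct)
  case (psubset W)
  show ?case
  proof (cases "N \<le> card W")
    case False
    from psubset.hyps obtain c where c: "bij_betw c W {0..<card W}"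
      using ex_bij_betw_finite_nat by blast
    have "t_component_set t G {v \<in> W. c v = i}" if "i < card W" for i
    proof -
      have "i \<in> c ` W" using that c by (simp add: bij_betw_def)
      then obtain u where u: "u \<in> W" "c u = i" by blast
      have "{v \<in> W. c v = i} = {u}"
        using u c by (auto simp: bij_betw_def inj_on_def)
      moreover have "t_component_set t G {u}"
        using u psubset.prems by (intro t_component_set_singleton[OF \<open>0 < t\<close>]) auto
      ultimately show ?thesis by simp
    qed
    moreover have "c ` W \<subseteq> {..<card W}" using c by (auto simp: bij_betw_def)
    moreover have "k * card W \<le> card W + k * N" using False by (simp add: trans_le_add2)
    ultimately show ?thesis by blast
  next
    case True
    from psubset.prems(2)[OF order_refl True] obtain T where T: "T \<subseteq> W" "card T = k" "t_component_set t G T"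
      by blast
    have "T \<noteq> {}" using T \<open>0 < k\<close> by auto
    have "\<exists>j c. c ` (W - T) \<subseteq> {..<j} \<and> (\<forall>i<j. t_component_set t G {v \<in> W - T. c v = i})
      \<and> k * j \<le> card (W - T) + k * N"
      using \<open>T \<noteq> {}\<close> T psubset.prems by (intro psubset.IH) auto
    then obtain j c where jc: "c ` (W - T) \<subseteq> {..<j}" "\<And>i. i < j \<Longrightarrow> t_component_set t G {v \<in> W - T. c v = i}"
      "k * j \<le> card (W - T) + k * N" by blast
    define c' where "c' v = (if v \<in> T then j else c v)" for v
    have "c' ` W \<subseteq> {..<Suc j}" using jc(1) by (force simp: c'_def)
    moreover have "t_component_set t G {v \<in> W. c' v = i}" if "i < Suc j" for i
    proof (cases "i = j")
      case True
      have "{v \<in> W. c' v = i} = T" using True jc(1) T(1) by (auto simp: c'_def)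
      thus ?thesis using T by simp
    next
      case False
      have "{v \<in> W. c' v = i} = {v \<in> W - T. c v = i}" using False by (auto simp: c'_def)
      thus ?thesis using jc(2) that False by simp
    qed
    moreover have "k * Suc j \<le> card W + k * N"
    proof -
      have "k \<le> card W" using T psubset.hyps card_mono by blast
      moreover have "card (W - T) = card W - k"
        using T psubset.hyps finite_subset[OF T(1)] by (simp add: card_Diff_subset)
      ultimately show ?thesis using jc(3) by simp
    qed
    ultimately show ?thesis by blast
  qed
qed

lemma chromatic_number_upper:
  fixes G :: "'a sgraph"
  assumes "0 < t" "0 < k" "finite (sverts G)"
    and "\<And>U. U \<subseteq> sverts G \<Longrightarrow> N \<le> card U \<Longrightarrow> \<exists>T\<subseteq>U. card T = k \<and> t_component_set t G T"
  shows "k * t_component_chromatic_number t G \<le> card (sverts G) + k * N"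
proof -
  obtain j c where "t_component_colouring t G j c" and j: "k * j \<le> card (sverts G) + k * N"
    using colouring_from_large_sets[of t k "sverts G" G N] assms
    by (auto simp: t_component_colouring_def)
  hence "t_component_chromatic_number t G \<le> j"
    unfolding t_component_chromatic_number_def by (intro Least_le) auto
  thus ?thesis using j by (meson le_trans mult_le_mono2)
qed

text \<open>Excluding the size \<open>k\<close> alone suffices: component sets are closed under
  subsets, so a larger colour class would contain one of size exactly \<open>k\<close>.\<close>

lemma chromatic_number_lower:
  fixes G :: "'a sgraph"
  assumes "0 < t" "finite (sverts G)"
    and small: "\<And>T. t_component_set t G T \<Longrightarrow> card T \<noteq> k"
  shows "card (sverts G) \<le> k * t_component_chromatic_number t G"
proof -
  define r where "r = t_component_chromatic_number t G"
  \<comment> \<open>No subset of \<open>sverts G\<close> is that large, so the greedy lemma applies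
    vacuously. It serves only to supply some colouring, without which the \<open>LEAST\<close> in
    the chromatic number would be unspecified.\<close>
  have "\<exists>T\<subseteq>U. card T = 1 \<and> t_component_set t G T" if "U \<subseteq> sverts G" "Suc (card (sverts G)) \<le> card U" for U
    using card_mono[OF assms(2) that(1)] that(2) by simp
  hence "\<exists>j c. c ` sverts G \<subseteq> {..<j} \<and> (\<forall>i<j. t_component_set t G {v \<in> sverts G. c v = i})
      \<and> 1 * j \<le> card (sverts G) + 1 * Suc (card (sverts G))"
    by (rule colouring_from_large_sets[OF assms(1) zero_less_one order_refl assms(2)])
  then obtain j c where "t_component_colouring t G j c"
    unfolding t_component_colouring_def by blast
  hence "\<exists>j c. t_component_colouring t G j c" by blast
  hence "\<exists>c. t_component_colouring t G r c"
    unfolding r_def t_component_chromatic_number_def by (rule LeastI_ex)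
  then obtain c where c: "t_component_colouring t G r c" ..
  have le: "card {v \<in> sverts G. c v = i} \<le> k" if "i < r" for i
  proof (rule ccontr)
    assume "\<not> ?thesis"
    hence "k \<le> card {v \<in> sverts G. c v = i}" by simp
    then obtain T where T: "T \<subseteq> {v \<in> sverts G. c v = i}" "card T = k"
      by (rule obtain_subset_with_card_n)
    have "t_component_set t G {v \<in> sverts G. c v = i}"
      using c that by (simp add: t_component_colouring_def)
    hence "t_component_set t G T" by (rule t_component_set_subset) (use T assms(2) in auto)
    thus False using small T(2) by blast
  qed
  have "c ` sverts G \<subseteq> {..<r}" using c by (simp add: t_component_colouring_def)
  hence "sverts G = (\<Union>i<r. {v \<in> sverts G. c v = i})" by blast
  hence "card (sverts G) = card (\<Union>i<r. {v \<in> sverts G. c v = i})" by (rule arg_cong)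
  also have "\<dots> \<le> (\<Sum>i<r. card {v \<in> sverts G. c v = i})"
    by (intro card_UN_le) auto
  also have "\<dots> \<le> (\<Sum>i<r. k)" using le by (intro sum_mono) auto
  finally show ?thesis by (simp add: r_def mult.commute)
qed

section \<open>Counting separated pairs\<close>

text \<open>Ordered pairs, so that counting reduces to cartesian products. Every edge of
  \<open>sep_edges\<close> appears twice, hence the factors 2 below.\<close>

definition sep_pairs :: "('a \<Rightarrow> 'b) \<Rightarrow> 'a set \<Rightarrow> ('a \<times> 'a) set" where
  "sep_pairs c T = {(u, v) \<in> T \<times> T. c u \<noteq> c v}"

text \<open>The edge set of the complete multipartite graph on \<open>T\<close> whose parts are the
  classes of \<open>c\<close>.\<close>

definition sep_edges :: "('a \<Rightarrow> 'b) \<Rightarrow> 'a set \<Rightarrow> 'a set set" where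
  "sep_edges c T = (\<lambda>(u, v). {u, v}) ` sep_pairs c T"

lemma finite_sep_pairs: "finite T \<Longrightarrow> finite (sep_pairs c T)"
  by (rule finite_subset[of _ "T \<times> T"]) (auto simp: sep_pairs_def)

lemma finite_sep_edges: "finite T \<Longrightarrow> finite (sep_edges c T)"
  by (simp add: sep_edges_def finite_sep_pairs)

lemma card_sep_pairs:
  fixes T :: "'a::linorder set"
  assumes "finite T"
  shows "card (sep_pairs c T) = 2 * card (sep_edges c T)"
proof -
  define H where "H = {(u, v) \<in> sep_pairs c T. u < v}"
  have fin: "finite H" unfolding H_def
    by (rule finite_subset[OF _ finite_sep_pairs[OF assms, of c]]) auto
  have "u < v \<or> v < u" if "c u \<noteq> c v" for u v using that by (metis linorder_neqE)
  hence eq: "sep_pairs c T = H \<union> prod.swap ` H"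
    unfolding H_def sep_pairs_def by (auto simp: image_iff) blast+
  have "H \<inter> prod.swap ` H = {}" by (auto simp: H_def)
  hence "card (sep_pairs c T) = card H + card (prod.swap ` H)"
    unfolding eq using fin by (intro card_Un_disjoint) auto
  also have "card (prod.swap ` H) = card H" by (intro card_image) auto
  finally have 1: "card (sep_pairs c T) = 2 * card H" by simp
  have "sep_edges c T = (\<lambda>(u, v). {u, v}) ` H"
    unfolding sep_edges_def eq image_Un image_image by (auto simp: insert_commute image_iff)
  moreover have "inj_on (\<lambda>(u, v). {u, v}) H"
    by (auto simp: inj_on_def H_def doubleton_eq_iff)
  ultimately have "card (sep_edges c T) = card H" by (simp add: card_image)
  with 1 show ?thesis by simp
qed

text \<open>For fixed \<open>j\<close> the left-hand side is the line touching the minimal number of separated pairs at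
  \<open>card T \<in> {j t..(j + 1) t}\<close>; removing a colour class needs the bounds for \<open>j\<close> and \<open>j - 1\<close>.\<close>

lemma card_sep_pairs_ge:
  fixes T :: "'a set" and t :: nat
  assumes "finite T" "\<And>u. u \<in> T \<Longrightarrow> card {v \<in> T. c v = c u} \<le> t"
  shows "2 * real j * real t * real (card T) - (real t)\<^sup>2 * real j * (real j + 1) \<le> real (card (sep_pairs c T))"
  using assms
proof (induction T arbitrary: j rule: finite_psubset_induct)
  case (psubset T)
  show ?case
  proof (cases "T = {}")
    case True
    thus ?thesis by (simp add: sep_pairs_def)
  next
    case False
    then obtain u where u: "u \<in> T" by auto
    define A where "A = {v \<in> T. c v = c u}"
    define T' where "T' = T - A"
    have fin: "finite A" "finite T'" and sub: "T' \<subset> T"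
      using psubset.hyps u by (auto simp: A_def T'_def)
    have IH: "2 * real j * real t * real (card T') - (real t)\<^sup>2 * real j * (real j + 1) \<le> real (card (sep_pairs c T'))" for j
    proof (rule psubset.IH[OF sub])
      fix w assume w: "w \<in> T'"
      have "card {v \<in> T'. c v = c w} \<le> card {v \<in> T. c v = c w}"
        using psubset.hyps by (intro card_mono) (auto simp: T'_def)
      thus "card {v \<in> T'. c v = c w} \<le> t" using psubset.prems[of w] w by (auto simp: T'_def)
    qed
    have "sep_pairs c T = sep_pairs c T' \<union> (A \<times> T' \<union> T' \<times> A)"
      by (auto simp: sep_pairs_def T'_def A_def)
    moreover have "card (sep_pairs c T' \<union> (A \<times> T' \<union> T' \<times> A)) = card (sep_pairs c T') + card (A \<times> T' \<union> T' \<times> A)"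
      using fin by (intro card_Un_disjoint finite_sep_pairs) (auto simp: sep_pairs_def T'_def)
    moreover have "card (A \<times> T' \<union> T' \<times> A) = card (A \<times> T') + card (T' \<times> A)"
      using fin by (intro card_Un_disjoint) (auto simp: T'_def)
    ultimately have card: "card (sep_pairs c T) = card (sep_pairs c T') + 2 * (card A * card T')"
      by (simp add: card_cartesian_product)
    define s x y where "s = real (card A)" and "x = real (card T')" and "y = real (card (sep_pairs c T'))"
    have st: "0 \<le> s" "s \<le> real t" "0 \<le> x" using psubset.prems[OF u] by (auto simp: s_def A_def x_def)
    have "card T = card A + card T'"
      unfolding T'_def using psubset.hyps fin by (subst card_Diff_subset) (auto simp: A_def card_mono)
    hence cT: "real (card T) = s + x" by (simp add: s_def x_def)
    \<comment> \<open>The removed class of size \<open>s\<close> accounts for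
      \<open>2 * (s * x)\<close> pairs. If \<open>x\<close> is at least \<open>j t\<close>, this
      covers the increase of the line for \<open>j\<close>. Otherwise the line for
      \<open>j - 1\<close> is used, and the difference of the two sides is
      \<open>2 (j t - x) (t - s)\<close>, which is nonnegative.\<close>
    have "2 * real j * real t * (s + x) - (real t)\<^sup>2 * real j * (real j + 1) \<le> y + 2 * (s * x)"
    proof (cases "real j * real t \<le> x")
      case True
      have "real j * real t * s \<le> x * s" using True st by (intro mult_right_mono)
      thus ?thesis using IH[of j] by (simp add: x_def y_def algebra_simps)
    next
      case False
      hence "j \<noteq> 0" using st(3) by (intro notI) simp
      then obtain i where j: "j = Suc i" by (cases j) auto
      have "x * (real t - s) \<le> (real j * real t) * (real t - s)"
        using False st by (intro mult_right_mono) auto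
      thus ?thesis using IH[of i] by (simp add: j x_def y_def algebra_simps power2_eq_square)
    qed
    thus ?thesis unfolding card cT by (simp add: s_def x_def y_def mult_ac)
  qed
qed

text \<open>Balancedness of the pattern with blocks \<open>i div t\<close>: no index set
  \<open>J\<close> spans more than \<open>c\<close> edges per vertex. Hypothesis \<open>c1\<close>
  is this bound for the \<open>m\<close> full blocks alone and \<open>c2\<close> for all
  \<open>k\<close> indices; these two extremal cases imply every other one.\<close>

lemma card_sep_pairs_div_le:
  fixes m t k :: nat and c :: real
  assumes "0 < t" "0 < m" "J \<subseteq> {..<k}" and k: "m * t \<le> k" "k \<le> (m + 1) * t"
    and c0: "0 \<le> c"
    and c1: "(real m - 1) * real t \<le> 2 * c"
    and c2: "real m * (real m - 1) * (real t)\<^sup>2 + 2 * real m * real t * (real k - real m * real t) \<le> 2 * c * real k"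
  shows "real (card (sep_pairs (\<lambda>i. i div t) J)) \<le> 2 * c * real (card J)"
proof -
  define Z where "Z = J \<inter> {..<m * t}"
  define Y where "Y = J \<inter> {m * t..<k}"
  define B where "B i = {v \<in> J. v div t = i}" for i
  have fin: "finite J" "finite Z" "finite Y" "\<And>i. finite (B i)"
    using finite_subset[OF assms(3)] by (auto simp: Z_def Y_def B_def)
  have J: "J = Z \<union> Y" "Z \<inter> Y = {}" using assms(3) by (auto simp: Z_def Y_def)
  have cJ: "card J = card Z + card Y" unfolding J(1) using J fin by (intro card_Un_disjoint) auto
  have Ydiv: "v div t = m" if "v \<in> Y" for v
  proof -
    have "m * t \<le> v" "v < Suc m * t" using that k by (auto simp: Y_def)
    thus ?thesis using \<open>0 < t\<close> by (intro div_nat_eqI) (auto simp: mult_ac)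
  qed
  have B_Z: "Z = (\<Union>i<m. B i)"
    using \<open>0 < t\<close> by (auto simp: Z_def B_def div_less_iff_less_mult)
  have cZ: "card Z = (\<Sum>i<m. card (B i))"
    unfolding B_Z using fin by (intro card_UN_disjoint) (auto simp: B_def)
  have "sep_pairs (\<lambda>i. i div t) J \<subseteq> (Z \<times> Z - (\<Union>i<m. B i \<times> B i)) \<union> (Z \<times> Y \<union> Y \<times> Z)"
    unfolding J(1) using Ydiv by (auto simp: sep_pairs_def B_def)
  hence "card (sep_pairs (\<lambda>i. i div t) J) \<le> card ((Z \<times> Z - (\<Union>i<m. B i \<times> B i)) \<union> (Z \<times> Y \<union> Y \<times> Z))"
    using fin by (intro card_mono) auto
  also have "\<dots> \<le> card (Z \<times> Z - (\<Union>i<m. B i \<times> B i)) + (card (Z \<times> Y) + card (Y \<times> Z))"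
    by (meson card_Un_le add_left_mono le_trans)
  also have "card (Z \<times> Z - (\<Union>i<m. B i \<times> B i)) = card Z * card Z - (\<Sum>i<m. card (B i) * card (B i))"
  proof -
    have "card (\<Union>i<m. B i \<times> B i) = (\<Sum>i<m. card (B i \<times> B i))"
      using fin by (intro card_UN_disjoint) (auto simp: B_def)
    moreover have "(\<Union>i<m. B i \<times> B i) \<subseteq> Z \<times> Z" by (auto simp: B_Z)
    ultimately show ?thesis using fin by (subst card_Diff_subset) (auto simp: card_cartesian_product)
  qed
  finally have le: "card (sep_pairs (\<lambda>i. i div t) J)
      \<le> card Z * card Z - (\<Sum>i<m. card (B i) * card (B i)) + 2 * (card Z * card Y)"
    by (simp add: card_cartesian_product mult_ac)
  define z y where "z = real (card Z)" and "y = real (card Y)"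
  \<comment> \<open>Cauchy-Schwarz: for a given size of \<open>Z\<close>, equally filled blocks
    separate the most pairs.\<close>
  have cs: "z\<^sup>2 \<le> real m * (\<Sum>i<m. (real (card (B i)))\<^sup>2)"
    using sum_squared_le_sum_of_squares[of "\<lambda>i. real (card (B i))" "{..<m}"]
    by (simp add: z_def cZ mult.commute)
  have sq: "(\<Sum>i<m. card (B i) * card (B i)) \<le> card Z * card Z"
  proof -
    have "(\<Sum>i<m. card (B i) * card (B i)) \<le> (\<Sum>i<m. card (B i) * card Z)"
      using fin by (intro sum_mono mult_left_mono card_mono) (auto simp: B_Z)
    thus ?thesis by (simp add: cZ sum_distrib_right)
  qed
  have "real (card (sep_pairs (\<lambda>i. i div t) J)) \<le> z\<^sup>2 - (\<Sum>i<m. (real (card (B i)))\<^sup>2) + 2 * z * y"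
  proof -
    have "real (card (sep_pairs (\<lambda>i. i div t) J))
        \<le> real (card Z * card Z - (\<Sum>i<m. card (B i) * card (B i)) + 2 * (card Z * card Y))"
      using le by (rule of_nat_mono)
    thus ?thesis using sq by (simp add: of_nat_diff z_def y_def power2_eq_square)
  qed
  also have "\<dots> \<le> 2 * c * (z + y)"
  proof -
    define \<sigma> where "\<sigma> = (\<Sum>i<m. (real (card (B i)))\<^sup>2)"
    define M T K where "M = real m" and "T = real t" and "K = real k"
    have M: "1 \<le> M" "0 < T" using \<open>0 < m\<close> \<open>0 < t\<close> by (auto simp: M_def T_def)
    have z: "0 \<le> z" "z \<le> M * T"
    proof -
      have "card Z \<le> card {..<m * t}" by (intro card_mono) (auto simp: Z_def)
      hence "real (card Z) \<le> real (m * t)" unfolding of_nat_le_iff by simp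
      thus "z \<le> M * T" by (simp add: z_def M_def T_def)
    qed (simp add: z_def)
    have y: "0 \<le> y" "y \<le> K - M * T"
    proof -
      have "card Y \<le> card {m * t..<k}" by (intro card_mono) (auto simp: Y_def)
      hence "real (card Y) \<le> real (k - m * t)" unfolding of_nat_le_iff by simp
      thus "y \<le> K - M * T" using k by (simp add: y_def M_def T_def K_def of_nat_diff)
    qed (simp add: y_def)
    have *: "M * (z\<^sup>2 - \<sigma> + 2 * z * y - 2 * c * (z + y)) \<le> (M - 1) * z\<^sup>2 + M * (2 * z * y - 2 * c * (z + y))"
      using cs by (simp add: \<sigma>_def M_def algebra_simps)
    \<comment> \<open>Convex in \<open>z\<close> and affine in \<open>y\<close>, so it suffices to look at the corners of the box.\<close>
    have "(M - 1) * z\<^sup>2 \<le> (M - 1) * (M * T * z)"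
      using M z by (intro mult_left_mono) (auto simp: power2_eq_square intro: mult_right_mono)
    hence "(M - 1) * z\<^sup>2 + M * (2 * z * y - 2 * c * (z + y))
        \<le> M * (z * ((M - 1) * T + 2 * y - 2 * c) - 2 * c * y)"
      by (simp add: algebra_simps)
    also have "\<dots> \<le> M * 0"
    proof (intro mult_left_mono)
      show "z * ((M - 1) * T + 2 * y - 2 * c) - 2 * c * y \<le> 0"
      proof (cases "(M - 1) * T + 2 * y - 2 * c \<le> 0")
        case True
        thus ?thesis using z y c0 by (smt (verit) mult_nonneg_nonpos mult_nonneg_nonneg)
      next
        case False
        hence "z * ((M - 1) * T + 2 * y - 2 * c) \<le> M * T * ((M - 1) * T + 2 * y - 2 * c)"
          using z by (intro mult_right_mono) auto
        \<comment> \<open>At \<open>z = M * T\<close> the difference of the two sides is affine in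
          \<open>y\<close> with slope \<open>2 * (M * T - c)\<close>. A nonpositive slope makes
          \<open>y = 0\<close> the worst case, settled by \<open>c1\<close>; otherwise it is
          \<open>y = K - M * T\<close>, settled by \<open>c2\<close>.\<close>
        moreover have "M * T * ((M - 1) * T + 2 * y - 2 * c) \<le> 2 * c * y"
        proof (cases "M * T \<le> c")
          case True
          have "M * T * ((M - 1) * T - 2 * c) \<le> 0"
            using M c1 by (intro mult_nonneg_nonpos) (auto simp: M_def T_def)
          moreover have "2 * y * (M * T - c) \<le> 0"
            using True y by (intro mult_nonneg_nonpos) auto
          ultimately show ?thesis by (simp add: algebra_simps)
        next
          case False
          have "y * (M * T - c) \<le> (K - M * T) * (M * T - c)"
            using False y by (intro mult_right_mono) auto
          moreover have "M * (M - 1) * T\<^sup>2 + 2 * M * T * (K - M * T) \<le> 2 * c * K"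
            using c2 by (simp add: M_def T_def K_def)
          ultimately show ?thesis by (simp add: algebra_simps power2_eq_square)
        qed
        ultimately show ?thesis by simp
      qed
    qed (use M in auto)
    finally have "M * (z\<^sup>2 - \<sigma> + 2 * z * y - 2 * c * (z + y)) \<le> 0" using * by simp
    hence "z\<^sup>2 - \<sigma> + 2 * z * y - 2 * c * (z + y) \<le> 0"
      using M by (simp add: mult_le_0_iff)
    thus ?thesis by (simp add: \<sigma>_def)
  qed
  finally show ?thesis by (simp add: cJ z_def y_def)
qed

section \<open>First moment and Janson bounds\<close>

text \<open>First moment over pairs of a set \<open>T\<close> and a labelling \<open>c\<close> of it
  with classes of size at most \<open>t\<close>. Such a pair certifies a component set only if all
  of \<open>sep_edges c T\<close> are non-edges, and there are at most \<open>n ^ k * k ^ k\<close>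
  pairs. The index \<open>j\<close> is free because every line bounds the number of separated pairs
  from below; the best one is picked later.\<close>

lemma prob_large_component_set_le:
  assumes p: "0 < p" "p < 1"
    and g: "g = real j * real t * real k - (real t)\<^sup>2 * real j * (real j + 1) / 2"
  shows "measure_pmf.prob (erdos_renyi n p) {G. \<exists>T. t_component_set t G T \<and> card T = k}
    \<le> real n ^ k * real k ^ k * (1 - p) powr g"
proof -
  define E where "E = potential_edges n"
  define I where "I = (SIGMA T:{T. T \<subseteq> {1..n} \<and> card T = k}.
    {c \<in> T \<rightarrow>\<^sub>E T. \<forall>u\<in>T. card {v \<in> T. c v = c u} \<le> t})"
  have finT: "finite T" if "T \<subseteq> {1..n}" for T using that finite_subset by blast
  have fin_inner: "finite {c \<in> T \<rightarrow>\<^sub>E T. \<forall>u\<in>T. card {v \<in> T. c v = c u} \<le> t}" if "T \<subseteq> {1..n}" for T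
    using finT[OF that] by (intro finite_subset[OF _ finite_PiE[of T "\<lambda>_. T"]]) auto
  have finI: "finite I"
    unfolding I_def using fin_inner by (intro finite_SigmaI) auto
  have edges_sub: "sep_edges c T \<subseteq> E" if "T \<subseteq> {1..n}" for c :: "nat \<Rightarrow> nat" and T :: "nat set"
    using that by (auto simp: sep_edges_def sep_pairs_def E_def potential_edges_def card_insert_if)
  have cover: "\<exists>x\<in>I. sep_edges (snd x) (fst x) \<subseteq> R"
    if R: "R \<subseteq> E" and T: "t_component_set t ({1..n}, E - R) T" "card T = k" for R T
  proof -
    have sub: "T \<subseteq> {1..n}" using T by (simp add: t_component_set_def)
    obtain c where c: "c \<in> T \<rightarrow>\<^sub>E T" "\<forall>u\<in>T. \<forall>v\<in>T. {u, v} \<in> E - R \<longrightarrow> c u = c v"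
      "\<forall>u\<in>T. card {v \<in> T. c v = c u} \<le> t"
      using t_component_set_class_function[OF T(1)] by auto
    have "(T, c) \<in> I" using sub T c by (auto simp: I_def)
    moreover have "sep_edges c T \<subseteq> R"
    proof
      fix e assume e_in: "e \<in> sep_edges c T"
      then obtain u v where e: "e = {u, v}" "u \<in> T" "v \<in> T" "c u \<noteq> c v"
        by (auto simp: sep_edges_def sep_pairs_def)
      have "e \<in> E" using e_in edges_sub[OF sub] by blast
      thus "e \<in> R" using c(2) e by blast
    qed
    ultimately show ?thesis by force
  qed
  have "measure_pmf.prob (erdos_renyi n p) {G. \<exists>T. t_component_set t G T \<and> card T = k}
      = rset_exp E (1 - p) (\<lambda>R. if \<exists>T. t_component_set t ({1..n}, E - R) T \<and> card T = k then 1 else 0)"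
    unfolding E_def using p by (subst prob_erdos_renyi) auto
  also have "\<dots> \<le> rset_exp E (1 - p) (\<lambda>R. if \<exists>x\<in>I. sep_edges (snd x) (fst x) \<subseteq> R then 1 else 0)"
    using p cover by (intro rset_exp_mono) auto
  also have "\<dots> \<le> (\<Sum>x\<in>I. rset_exp E (1 - p) (\<lambda>R. if sep_edges (snd x) (fst x) \<subseteq> R then 1 else 0))"
    using p finI by (intro rset_exp_union_bound) (auto simp: E_def)
  also have "\<dots> \<le> (\<Sum>x\<in>I. (1 - p) powr g)"
  proof (rule sum_mono)
    fix x assume "x \<in> I"
    then obtain T c where x: "x = (T, c)" and T: "T \<subseteq> {1..n}" "card T = k"
      and c: "\<And>u. u \<in> T \<Longrightarrow> card {v \<in> T. c v = c u} \<le> t" by (auto simp: I_def)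
    have "2 * g \<le> real (card (sep_pairs c T))"
      using card_sep_pairs_ge[OF finT[OF T(1)] c, of j] T by (simp add: g mult_ac)
    hence "g \<le> real (card (sep_edges c T))"
      using card_sep_pairs[OF finT[OF T(1)], of c] by simp
    hence "(1 - p) powr real (card (sep_edges c T)) \<le> (1 - p) powr g"
      using p by (intro powr_mono') auto
    thus "rset_exp E (1 - p) (\<lambda>R. if sep_edges (snd x) (fst x) \<subseteq> R then 1 else 0) \<le> (1 - p) powr g"
      using p edges_sub[OF T(1), of c]
      by (simp add: x rset_exp_indicator_superset E_def powr_realpow)
  qed
  also have "\<dots> = real (card I) * (1 - p) powr g" by simp
  also have "\<dots> \<le> real (n ^ k * k ^ k) * (1 - p) powr g"
  proof (intro mult_right_mono of_nat_mono)
    have "card I = (\<Sum>T\<in>{T. T \<subseteq> {1..n} \<and> card T = k}.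
        card {c \<in> T \<rightarrow>\<^sub>E T. \<forall>u\<in>T. card {v \<in> T. c v = c u} \<le> t})"
      unfolding I_def using fin_inner by (intro card_SigmaI) auto
    also have "\<dots> \<le> (\<Sum>T\<in>{T. T \<subseteq> {1..n} \<and> card T = k}. k ^ k)"
    proof (rule sum_mono)
      fix T assume T: "T \<in> {T. T \<subseteq> {1..n} \<and> card T = k}"
      have "card {c \<in> T \<rightarrow>\<^sub>E T. \<forall>u\<in>T. card {v \<in> T. c v = c u} \<le> t} \<le> card (T \<rightarrow>\<^sub>E T)"
        using T finT[of T] by (intro card_mono finite_PiE) auto
      also have "\<dots> = k ^ k" using T finT[of T] by (subst card_PiE) auto
      finally show "card {c \<in> T \<rightarrow>\<^sub>E T. \<forall>u\<in>T. card {v \<in> T. c v = c u} \<le> t} \<le> k ^ k" .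
    qed
    also have "\<dots> = (n choose k) * k ^ k" using n_subsets[of "{1..n}" k] by simp
    also have "\<dots> \<le> n ^ k * k ^ k"
      by (cases "k \<le> n") (auto intro: binomial_le_pow mult_right_mono simp: binomial_eq_0)
    finally show "card I \<le> n ^ k * k ^ k" .
  qed auto
  finally show ?thesis by simp
qed

lemma sep_edges_subset_Pow: "sep_edges c T \<subseteq> Pow T"
  by (auto simp: sep_edges_def sep_pairs_def)

text \<open>The pattern is only embedded with its \<open>i\<close>-th vertex in the \<open>i\<close>-th of \<open>k\<close> disjoint pools of size \<open>w\<close>;
  then two embeddings can overlap only at indices where they agree.\<close>

lemma no_component_set_prob:
  fixes U :: "nat set" and t k w n :: nat
  assumes q: "0 < q" "q \<le> 1" and t: "0 < t" and w: "0 < w"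
    and U: "U \<subseteq> {1..n}" "k * w \<le> card U"
    and D: "0 < D" "(\<Sum>J\<in>Pow {..<k}. if 2 \<le> card J then (1 / real w) ^ card J *
      (1 / q) ^ card (sep_edges (\<lambda>i. i div t) J) else 0) \<le> D"
  shows "rset_exp (potential_edges n) q
      (\<lambda>R. if \<exists>T\<subseteq>U. card T = k \<and> t_component_set t ({1..n}, potential_edges n - R) T then 0 else 1)
    \<le> exp (- 1 / (2 * D))"
proof -
  define E where "E = potential_edges n"
  define K where "K = sep_edges (\<lambda>i. i div t) {..<k}"
  define s where "s = card K"
  define I where "I = {..<k} \<rightarrow>\<^sub>E {..<w}"
  \<comment> \<open>Weight of an overlap relative to \<open>q ^ (2 * s)\<close>. Copies agreeing in
    fewer than two indices share no edge and are absent from Janson's sum.\<close>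
  define F where "F J = (if 2 \<le> card J then (1 / q) ^ card (sep_edges (\<lambda>i. i div t) J) else 0)" for J
  have finU: "finite U" using U finite_subset by blast
  have finI: "finite I" unfolding I_def by (intro finite_PiE) auto
  have cardI: "card I = w ^ k" unfolding I_def by (subst card_PiE) auto
  have "card ({..<k} \<times> {..<w}) \<le> card U" using U by simp
  then obtain h where h: "h ` ({..<k} \<times> {..<w}) \<subseteq> U" "inj_on h ({..<k} \<times> {..<w})"
    using card_le_inj[of "{..<k} \<times> {..<w}" U] finU by auto
  define vert where "vert \<phi> i = h (i, \<phi> i)" for \<phi> :: "nat \<Rightarrow> nat" and i
  define S where "S \<phi> = image (vert \<phi>) ` K" for \<phi>
  have I_in: "(i, \<phi> i) \<in> {..<k} \<times> {..<w}" if "\<phi> \<in> I" "i < k" for \<phi> i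
    using that by (auto simp: I_def)
  \<comment> \<open>The pools are disjoint because \<open>h\<close> is injective, so a common vertex
    reveals both the index and the choice made there. Shared edges therefore join indices on which
    the two copies agree.\<close>
  have vert_eq: "i = j \<and> \<phi> i = \<psi> j" if "\<phi> \<in> I" "\<psi> \<in> I" "i < k" "j < k" "vert \<phi> i = vert \<psi> j" for \<phi> \<psi> i j
    using inj_onD[OF h(2) _ I_in[OF that(1,3)] I_in[OF that(2,4)]] that(5) by (auto simp: vert_def)
  have vert_inj: "inj_on (vert \<phi>) {..<k}" if "\<phi> \<in> I" for \<phi>
    using vert_eq[OF that that] by (auto simp: inj_on_def)
  have vert_U: "vert \<phi> i \<in> U" if "\<phi> \<in> I" "i < k" for \<phi> i
    using h(1) I_in[OF that] by (auto simp: vert_def)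
  have vert_V: "vert \<phi> i \<in> {1..n}" if "\<phi> \<in> I" "i < k" for \<phi> i
    using vert_U[OF that] U by blast
  have K_Pow: "K \<subseteq> Pow {..<k}" unfolding K_def by (rule sep_edges_subset_Pow)
  have finK: "finite K" unfolding K_def by (intro finite_sep_edges) auto
  have K_iff: "e \<in> K \<longleftrightarrow> (\<exists>i j. e = {i, j} \<and> i < k \<and> j < k \<and> i div t \<noteq> j div t)" for e
    by (auto simp: K_def sep_edges_def sep_pairs_def)
  have card_S: "card (S \<phi>) = s" if "\<phi> \<in> I" for \<phi>
    unfolding S_def s_def
    by (intro card_image inj_on_subset[OF inj_on_image_Pow[OF vert_inj[OF that]] K_Pow])
  have finS: "finite (S \<phi>)" for \<phi> using finK by (simp add: S_def)
  have S_sub: "S \<phi> \<subseteq> E" if \<phi>: "\<phi> \<in> I" for \<phi>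
  proof
    fix e assume "e \<in> S \<phi>"
    then obtain i j where ij: "e = {vert \<phi> i, vert \<phi> j}" "i < k" "j < k" "i div t \<noteq> j div t"
      by (auto simp: S_def K_iff)
    have "vert \<phi> i \<noteq> vert \<phi> j" using vert_eq[OF \<phi> \<phi> ij(2,3)] ij(4) by auto
    thus "e \<in> E" using ij vert_V[OF \<phi> ij(2)] vert_V[OF \<phi> ij(3)]
      by (auto simp: E_def potential_edges_def)
  qed
  have S_Int: "S \<phi> \<inter> S \<psi> \<subseteq> image (vert \<phi>) ` sep_edges (\<lambda>i. i div t) {i. i < k \<and> \<phi> i = \<psi> i}"
    if \<phi>: "\<phi> \<in> I" and \<psi>: "\<psi> \<in> I" for \<phi> \<psi>
  proof
    fix e assume "e \<in> S \<phi> \<inter> S \<psi>"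
    then obtain a b where a: "a \<in> K" "e = vert \<phi> ` a" and b: "b \<in> K" "e = vert \<psi> ` b"
      by (auto simp: S_def)
    have "\<phi> i = \<psi> i" if "i \<in> a" for i
    proof -
      have "vert \<phi> i \<in> vert \<psi> ` b" using that a b by auto
      then obtain j where "j \<in> b" "vert \<phi> i = vert \<psi> j" by auto
      thus ?thesis using vert_eq[OF \<phi> \<psi>, of i j] that a b K_Pow by auto
    qed
    moreover obtain i j where "a = {i, j}" "i < k" "j < k" "i div t \<noteq> j div t"
      using a K_iff by auto
    ultimately have "a \<in> sep_edges (\<lambda>i. i div t) {i. i < k \<and> \<phi> i = \<psi> i}"
      by (auto simp: sep_edges_def sep_pairs_def)
    thus "e \<in> image (vert \<phi>) ` sep_edges (\<lambda>i. i div t) {i. i < k \<and> \<phi> i = \<psi> i}"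
      using a by auto
  qed
  have pair: "(if S \<phi> \<inter> S \<psi> = {} then 0 else q ^ card (S \<phi> \<union> S \<psi>)) \<le> q ^ (2 * s) * F {i. i < k \<and> \<phi> i = \<psi> i}"
    if \<phi>: "\<phi> \<in> I" and \<psi>: "\<psi> \<in> I" for \<phi> \<psi>
  proof (cases "S \<phi> \<inter> S \<psi> = {}")
    case True
    thus ?thesis using q by (simp add: F_def)
  next
    case False
    define J where "J = {i. i < k \<and> \<phi> i = \<psi> i}"
    have finJ: "finite J" by (simp add: J_def)
    obtain a where "a \<in> sep_edges (\<lambda>i. i div t) J" using False S_Int[OF \<phi> \<psi>] by (auto simp: J_def)
    then obtain i j where "{i, j} \<subseteq> J" "i \<noteq> j" by (auto simp: sep_edges_def sep_pairs_def)
    hence J2: "2 \<le> card J" using card_mono[OF finJ, of "{i, j}"] by auto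
    have "card (S \<phi> \<inter> S \<psi>) \<le> card (image (vert \<phi>) ` sep_edges (\<lambda>i. i div t) J)"
      using S_Int[OF \<phi> \<psi>] finJ by (intro card_mono finite_imageI finite_sep_edges) (auto simp: J_def)
    also have "\<dots> \<le> card (sep_edges (\<lambda>i. i div t) J)"
      using finJ by (intro card_image_le finite_sep_edges)
    finally have le: "card (S \<phi> \<inter> S \<psi>) \<le> card (sep_edges (\<lambda>i. i div t) J)" .
    have "2 * s = card (S \<phi> \<union> S \<psi>) + card (S \<phi> \<inter> S \<psi>)"
      using card_Un_Int[OF finS finS, of \<phi> \<psi>] card_S[OF \<phi>] card_S[OF \<psi>] by simp
    hence "q ^ card (S \<phi> \<union> S \<psi>) = q ^ (2 * s) * (1 / q) ^ card (S \<phi> \<inter> S \<psi>)"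
      using q by (simp add: power_add power_divide)
    also have "\<dots> \<le> q ^ (2 * s) * (1 / q) ^ card (sep_edges (\<lambda>i. i div t) J)"
      using q le by (intro mult_left_mono power_increasing) auto
    finally show ?thesis using False J2 by (simp add: F_def J_def)
  qed
  \<comment> \<open>On \<open>J\<close> the choices are dictated by \<open>\<phi>\<close> and
    elsewhere they are free. The requirement to differ from \<open>\<phi>\<close> outside
    \<open>J\<close> is dropped, which only enlarges the count.\<close>
  have agree: "card {\<psi> \<in> I. {i. i < k \<and> \<phi> i = \<psi> i} = J} \<le> w ^ (k - card J)"
    if "J \<subseteq> {..<k}" for \<phi> J
  proof -
    define P where "P = Pi\<^sub>E {..<k} (\<lambda>i. if i \<in> J then {\<phi> i} else {..<w})"
    have "\<psi> \<in> P" if "\<psi> \<in> I" "{i. i < k \<and> \<phi> i = \<psi> i} = J" for \<psi>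
      unfolding P_def
    proof (rule PiE_I)
      fix i
      have \<psi>: "\<psi> \<in> {..<k} \<rightarrow>\<^sub>E {..<w}" using that(1) by (simp add: I_def)
      show "\<psi> i \<in> (if i \<in> J then {\<phi> i} else {..<w})" if "i \<in> {..<k}"
        using PiE_mem[OF \<psi> that] \<open>{i. i < k \<and> \<phi> i = \<psi> i} = J\<close> by auto
      show "\<psi> i = undefined" if "i \<notin> {..<k}"
        using PiE_arb[OF \<psi> that] .
    qed
    hence "{\<psi> \<in> I. {i. i < k \<and> \<phi> i = \<psi> i} = J} \<subseteq> P" by blast
    moreover have "finite P" unfolding P_def by (rule finite_PiE) auto
    ultimately have "card {\<psi> \<in> I. {i. i < k \<and> \<phi> i = \<psi> i} = J} \<le> card P"
      by (intro card_mono)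
    also have "card P = (\<Prod>i<k. card (if i \<in> J then {\<phi> i} else {..<w}))"
      unfolding P_def by (rule card_PiE) simp
    also have "\<dots> = (\<Prod>i<k. if i \<in> J then 1 else w)"
      by (rule prod.cong) auto
    also have "\<dots> = (\<Prod>i\<in>{..<k} - J. w)"
      by (rule prod.mono_neutral_cong_right) auto
    also have "\<dots> = w ^ (k - card J)"
      using that finite_subset[OF that] by (simp add: card_Diff_subset)
    finally show ?thesis .
  qed
  have F_nn: "0 \<le> F J" for J using q by (simp add: F_def)
  have inner: "(\<Sum>\<psi>\<in>I. F {i. i < k \<and> \<phi> i = \<psi> i}) \<le> real w ^ k * D" for \<phi>
  proof -
    have "(\<Sum>\<psi>\<in>I. F {i. i < k \<and> \<phi> i = \<psi> i})
      = (\<Sum>J\<in>Pow {..<k}. \<Sum>\<psi>\<in>{\<psi> \<in> I. {i. i < k \<and> \<phi> i = \<psi> i} = J}. F {i. i < k \<and> \<phi> i = \<psi> i})"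
      using finI by (intro sum.group[symmetric]) auto
    also have "\<dots> = (\<Sum>J\<in>Pow {..<k}. real (card {\<psi> \<in> I. {i. i < k \<and> \<phi> i = \<psi> i} = J}) * F J)"
      by (intro sum.cong refl) simp
    also have "\<dots> \<le> (\<Sum>J\<in>Pow {..<k}. real w ^ k * (if 2 \<le> card J then (1 / real w) ^ card J *
      (1 / q) ^ card (sep_edges (\<lambda>i. i div t) J) else 0))"
    proof (rule sum_mono)
      fix J assume J: "J \<in> Pow {..<k}"
      have cJ: "card J \<le> k" using J card_mono[of "{..<k}" J] by auto
      have "real (card {\<psi> \<in> I. {i. i < k \<and> \<phi> i = \<psi> i} = J}) * F J \<le> real (w ^ (k - card J)) * F J"
        using agree[of J \<phi>] J F_nn by (intro mult_right_mono of_nat_mono) auto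
      also have "real (w ^ (k - card J)) = real w ^ k * (1 / real w) ^ card J"
        unfolding of_nat_power using w cJ power_diff[of "real w" "card J" k] by (simp add: power_divide)
      finally show "real (card {\<psi> \<in> I. {i. i < k \<and> \<phi> i = \<psi> i} = J}) * F J
        \<le> real w ^ k * (if 2 \<le> card J then (1 / real w) ^ card J *
          (1 / q) ^ card (sep_edges (\<lambda>i. i div t) J) else 0)"
        by (simp add: F_def mult_ac split: if_splits)
    qed
    also have "\<dots> \<le> real w ^ k * D"
      unfolding sum_distrib_left[symmetric] using D w by (intro mult_left_mono) auto
    finally show ?thesis .
  qed
  \<comment> \<open>With mean \<open>\<mu> = real w ^ k * q ^ s\<close> this is
    \<open>\<mu>\<^sup>2 * D\<close>, so Janson's exponent becomes \<open>- 1 / (2 * D)\<close>: the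
    quantity \<open>D\<close> is the normalised overlap sum.\<close>
  define \<Delta> where "\<Delta> = q ^ (2 * s) * (real w ^ k * (real w ^ k * D))"
  have "(\<Sum>\<phi>\<in>I. \<Sum>\<psi>\<in>I. if S \<phi> \<inter> S \<psi> = {} then 0 else q ^ card (S \<phi> \<union> S \<psi>))
      \<le> (\<Sum>\<phi>\<in>I. \<Sum>\<psi>\<in>I. q ^ (2 * s) * F {i. i < k \<and> \<phi> i = \<psi> i})"
    by (intro sum_mono pair)
  also have "\<dots> = q ^ (2 * s) * (\<Sum>\<phi>\<in>I. \<Sum>\<psi>\<in>I. F {i. i < k \<and> \<phi> i = \<psi> i})"
    by (simp add: sum_distrib_left)
  also have "\<dots> \<le> q ^ (2 * s) * (\<Sum>\<phi>\<in>I. real w ^ k * D)"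
    using q by (intro mult_left_mono sum_mono inner) auto
  also have "\<dots> = \<Delta>" by (simp add: \<Delta>_def cardI)
  finally have \<Delta>_le: "(\<Sum>\<phi>\<in>I. \<Sum>\<psi>\<in>I. if S \<phi> \<inter> S \<psi> = {} then 0 else q ^ card (S \<phi> \<union> S \<psi>)) \<le> \<Delta>" .
  have "0 < \<Delta>" using q w D by (simp add: \<Delta>_def)
  have comp: "\<exists>T\<subseteq>U. card T = k \<and> t_component_set t ({1..n}, E - R) T"
    if \<phi>: "\<phi> \<in> I" and R: "S \<phi> \<subseteq> R" for \<phi> R
  proof (intro exI conjI)
    let ?T = "vert \<phi> ` {..<k}"
    let ?c = "\<lambda>v. the_inv_into {..<k} (vert \<phi>) v div t"
    have inv: "the_inv_into {..<k} (vert \<phi>) (vert \<phi> i) = i" if "i < k" for i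
      using the_inv_into_f_f[OF vert_inj[OF \<phi>]] that by auto
    show "?T \<subseteq> U" using vert_U[OF \<phi>] by auto
    show "card ?T = k" using card_image[OF vert_inj[OF \<phi>]] by simp
    show "t_component_set t ({1..n}, E - R) ?T"
    proof (rule t_component_setI[where c = ?c])
      show "?T \<subseteq> sverts ({1..n}, E - R)" using vert_V[OF \<phi>] by auto
      show "finite ?T" by simp
      show "?c u = ?c v" if uv: "u \<in> ?T" "v \<in> ?T" "{u, v} \<in> sedges ({1..n}, E - R)" for u v
      proof (rule ccontr)
        assume neq: "?c u \<noteq> ?c v"
        obtain i j where ij: "u = vert \<phi> i" "v = vert \<phi> j" "i < k" "j < k" using uv by auto
        have "{i, j} \<in> K" using neq ij inv by (auto simp: K_iff)
        hence "vert \<phi> ` {i, j} \<in> S \<phi>" unfolding S_def by (rule imageI)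
        thus False using R uv ij by auto
      qed
      show "card {v \<in> ?T. ?c v = ?c u} \<le> t" if "u \<in> ?T" for u
      proof -
        define x where "x = ?c u"
        have "{v \<in> ?T. ?c v = x} \<subseteq> vert \<phi> ` {x * t..<x * t + t}"
        proof
          fix v assume "v \<in> {v \<in> ?T. ?c v = x}"
          then obtain i where i: "v = vert \<phi> i" "i div t = x" using inv by auto
          have "x * t \<le> i" "i < x * t + t"
            using i(2) div_mult_mod_eq[of i t] mod_less_divisor[OF t, of i] by auto
          thus "v \<in> vert \<phi> ` {x * t..<x * t + t}" using i by auto
        qed
        hence "card {v \<in> ?T. ?c v = x} \<le> card (vert \<phi> ` {x * t..<x * t + t})"
          by (intro card_mono) auto
        also have "\<dots> \<le> card {x * t..<x * t + t}" by (rule card_image_le) simp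
        finally show ?thesis by (simp add: x_def)
      qed
    qed
  qed
  have "rset_exp E q (\<lambda>R. if \<exists>T\<subseteq>U. card T = k \<and> t_component_set t ({1..n}, E - R) T then 0 else 1)
    \<le> rset_exp E q (\<lambda>R. if \<exists>\<phi>\<in>I. S \<phi> \<subseteq> R then 0 else 1)"
    using q comp by (intro rset_exp_mono) auto
  also have "\<dots> \<le> exp (- (\<Sum>\<phi>\<in>I. q ^ card (S \<phi>))\<^sup>2 / (2 * \<Delta>))"
    using q finI S_sub \<open>0 < \<Delta>\<close> \<Delta>_le by (intro janson_inequality) (auto simp: E_def)
  also have "(\<Sum>\<phi>\<in>I. q ^ card (S \<phi>)) = real w ^ k * q ^ s"
    by (simp add: card_S cardI)
  also have "- (real w ^ k * q ^ s)\<^sup>2 / (2 * \<Delta>) = - 1 / (2 * D)"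
    using q w by (simp add: \<Delta>_def power2_eq_square power_mult power_mult_distrib field_simps)
  finally show ?thesis by (simp add: E_def)
qed

text \<open>The greedy colouring needs a component set of size \<open>k\<close> in every
  \<open>U\<close> with at least \<open>k * w\<close> vertices. A union bound over all such
  \<open>U\<close> costs at most \<open>2 ^ n\<close>.\<close>

lemma prob_chromatic_number_large_le:
  assumes p: "0 < p" "p < 1" and t: "0 < t" and w: "0 < w" and k: "0 < k"
    and D: "0 < D" "(\<Sum>J\<in>Pow {..<k}. if 2 \<le> card J then (1 / real w) ^ card J *
      (1 / (1 - p)) ^ card (sep_edges (\<lambda>i. i div t) J) else 0) \<le> D"
  shows "measure_pmf.prob (erdos_renyi n p)
      {G. \<not> k * t_component_chromatic_number t G \<le> n + k * (k * w)} \<le> 2 ^ n * exp (- 1 / (2 * D))"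
proof -
  define E where "E = potential_edges n"
  define I where "I = {U. U \<subseteq> {1..n} \<and> k * w \<le> card U}"
  define bad where "bad U R \<longleftrightarrow> \<not> (\<exists>T\<subseteq>U. card T = k \<and> t_component_set t ({1..n}, E - R) T)" for U R
  have I_sub: "I \<subseteq> Pow {1..n}" by (auto simp: I_def)
  hence finI: "finite I" by (rule finite_subset) simp
  have cover: "\<exists>U\<in>I. bad U R"
    if "\<not> k * t_component_chromatic_number t ({1..n}, E - R) \<le> n + k * (k * w)" for R
  proof (rule ccontr)
    assume *: "\<not> ?thesis"
    have "k * t_component_chromatic_number t ({1..n}, E - R) \<le> card (sverts ({1..n}, E - R)) + k * (k * w)"
      using * t k by (intro chromatic_number_upper) (auto simp: bad_def I_def)
    thus False using that by simp
  qed
  have "measure_pmf.prob (erdos_renyi n p)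
      {G. \<not> k * t_component_chromatic_number t G \<le> n + k * (k * w)}
      = rset_exp E (1 - p) (\<lambda>R. if \<not> k * t_component_chromatic_number t ({1..n}, E - R) \<le> n + k * (k * w) then 1 else 0)"
    unfolding E_def using p by (subst prob_erdos_renyi) auto
  also have "\<dots> \<le> rset_exp E (1 - p) (\<lambda>R. if \<exists>U\<in>I. bad U R then 1 else 0)"
    using p cover by (intro rset_exp_mono) auto
  also have "\<dots> \<le> (\<Sum>U\<in>I. rset_exp E (1 - p) (\<lambda>R. if bad U R then 1 else 0))"
    using p finI by (intro rset_exp_union_bound) (auto simp: E_def)
  also have "\<dots> \<le> (\<Sum>U\<in>I. exp (- 1 / (2 * D)))"
  proof (rule sum_mono)
    fix U assume U: "U \<in> I"
    have "rset_exp E (1 - p) (\<lambda>R. if bad U R then 1 else 0)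
      = rset_exp E (1 - p) (\<lambda>R. if \<exists>T\<subseteq>U. card T = k \<and> t_component_set t ({1..n}, E - R) T then 0 else 1)"
      by (intro rset_exp_cong) (auto simp: bad_def)
    also have "\<dots> \<le> exp (- 1 / (2 * D))"
      unfolding E_def using p t w D U by (intro no_component_set_prob) (auto simp: I_def)
    finally show "rset_exp E (1 - p) (\<lambda>R. if bad U R then 1 else 0) \<le> exp (- 1 / (2 * D))" .
  qed
  also have "\<dots> \<le> 2 ^ n * exp (- 1 / (2 * D))"
  proof -
    have "card I \<le> card (Pow {1..n})" using I_sub by (intro card_mono) auto
    hence "real (card I) \<le> real (2 ^ n)" unfolding of_nat_le_iff by (simp add: card_Pow)
    thus ?thesis by simp
  qed
  finally show ?thesis .
qed

section \<open>The positive root of iota and the overlap sum\<close>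

text \<open>The bracket is the line with \<open>j = \<lfloor>x / \<tau>\<rfloor>\<close>, which
  attains the maximum defining \<open>f\<close> at \<open>x\<close>.\<close>

lemma iota_eq:
  fixes \<tau> x :: real
  defines "M \<equiv> real_of_int \<lfloor>x / \<tau>\<rfloor>"
  shows "iota \<tau> x = x - (M * \<tau> * x - \<tau>\<^sup>2 * M * (M + 1) / 2)"
  by (simp add: iota_def M_def field_simps power2_eq_square)

text \<open>The root is where the line of \<open>f\<close> with index
  \<open>m = \<lceil>2 / \<tau>\<rceil>\<close> meets the diagonal. The condition
  \<open>(m - 1) \<tau> < 2\<close> puts this point to the right of \<open>m \<tau>\<close>, and
  \<open>2 \<le> m \<tau>\<close> puts it at or below \<open>(m + 1) \<tau>\<close>.\<close>

lemma iota_positive_root: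
  fixes \<tau> :: real
  assumes \<tau>: "0 < \<tau>"
  obtains m :: nat and \<kappa> :: real where "0 < m" "(real m - 1) * \<tau> < 2" "2 \<le> real m * \<tau>"
    "\<kappa> * (real m * \<tau> - 1) = \<tau>\<^sup>2 * real m * (real m + 1) / 2"
    "real m * \<tau> < \<kappa>" "\<kappa> \<le> (real m + 1) * \<tau>"
    "\<And>x. 0 < x \<and> iota \<tau> x = 0 \<longleftrightarrow> x = \<kappa>"
proof -
  define m where "m = nat \<lceil>2 / \<tau>\<rceil>"
  define M where "M = real m"
  define \<kappa> where "\<kappa> = \<tau>\<^sup>2 * M * (M + 1) / (2 * (M * \<tau> - 1))"
  have M_int: "M = real_of_int \<lceil>2 / \<tau>\<rceil>" using \<tau> by (simp add: M_def m_def)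
  have "2 / \<tau> \<le> M" "M < 2 / \<tau> + 1" unfolding M_int by linarith+
  hence M: "2 \<le> M * \<tau>" "(M - 1) * \<tau> < 2" using \<tau> by (simp_all add: field_simps)
  have "0 < M" using M \<tau> by (smt (verit) mult_nonpos_nonneg)
  hence m: "0 < m" "1 \<le> M" by (simp_all add: M_def)
  have root: "\<kappa> * (M * \<tau> - 1) = \<tau>\<^sup>2 * M * (M + 1) / 2" using M by (simp add: \<kappa>_def field_simps)
  have pos: "0 < M * \<tau>" using M by simp
  have lower: "M * \<tau> < \<kappa>"
  proof -
    have "M * \<tau> * ((M - 1) * \<tau>) < M * \<tau> * 2" using M pos by (intro mult_strict_left_mono)
    hence "M * \<tau> * (M * \<tau> - 1) < \<kappa> * (M * \<tau> - 1)"
      unfolding root by (simp add: field_simps power2_eq_square)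
    thus ?thesis using M by (simp add: mult_less_cancel_right)
  qed
  have upper: "\<kappa> \<le> (M + 1) * \<tau>"
  proof -
    have "(M + 1) * \<tau> * 2 \<le> (M + 1) * \<tau> * (M * \<tau>)" using M \<tau> m by (intro mult_left_mono) auto
    hence "\<kappa> * (M * \<tau> - 1) \<le> (M + 1) * \<tau> * (M * \<tau> - 1)"
      unfolding root by (simp add: field_simps power2_eq_square)
    thus ?thesis using M by (simp add: mult_le_cancel_right)
  qed
  have iff: "0 < x \<and> iota \<tau> x = 0 \<longleftrightarrow> x = \<kappa>" for x
  proof
    assume x: "x = \<kappa>"
    have "0 < x" using lower pos x by linarith
    \<comment> \<open>At the right end of the piece the floor is already \<open>M + 1\<close>, but
      the lines for \<open>M\<close> and \<open>M + 1\<close> agree there.\<close>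
    moreover have "iota \<tau> x = 0"
    proof (cases "\<kappa> = (M + 1) * \<tau>")
      case True
      have "real_of_int \<lfloor>x / \<tau>\<rfloor> = M + 1" using \<tau> True x by (simp add: M_def)
      thus ?thesis using root unfolding iota_eq x True
        by (simp add: algebra_simps power2_eq_square)
    next
      case False
      have "\<lfloor>x / \<tau>\<rfloor> = int m"
        using \<tau> lower upper False x by (intro floor_unique) (auto simp: M_def field_simps)
      hence "real_of_int \<lfloor>x / \<tau>\<rfloor> = M" by (simp add: M_def)
      thus ?thesis using root unfolding iota_eq x by (simp add: field_simps)
    qed
    ultimately show "0 < x \<and> iota \<tau> x = 0" by simp
  next
    assume x: "0 < x \<and> iota \<tau> x = 0"
    define N where "N = real_of_int \<lfloor>x / \<tau>\<rfloor>"
    have "0 \<le> \<lfloor>x / \<tau>\<rfloor>" using x \<tau> by simp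
    hence N0: "0 \<le> N" by (simp add: N_def)
    have "N \<le> x / \<tau>" "x / \<tau> < N + 1" by (simp_all add: N_def)
    hence Nx: "N * \<tau> \<le> x" "x < (N + 1) * \<tau>" using \<tau> by (simp_all add: field_simps)
    have eq: "x * (N * \<tau> - 1) = \<tau>\<^sup>2 * N * (N + 1) / 2"
      using x iota_eq[of \<tau> x, folded N_def] by (simp add: field_simps)
    have "N \<noteq> 0" using eq x by auto
    hence N1: "0 < N" using N0 by simp
    hence "0 < x * (N * \<tau> - 1)" unfolding eq using \<tau> by simp
    hence N\<tau>: "0 < N * \<tau> - 1" using x by (simp add: zero_less_mult_iff)
    have "N * \<tau> * (N * \<tau> - 1) \<le> x * (N * \<tau> - 1)" using Nx N\<tau> by (intro mult_right_mono) auto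
    hence "N * \<tau> * ((N - 1) * \<tau>) \<le> N * \<tau> * 2"
      unfolding eq by (simp add: field_simps power2_eq_square)
    hence up: "(N - 1) * \<tau> \<le> 2" using N1 \<tau> by (simp add: mult_le_cancel_left)
    have "x * (N * \<tau> - 1) < (N + 1) * \<tau> * (N * \<tau> - 1)" using Nx N\<tau> by (intro mult_strict_right_mono) auto
    hence "(N + 1) * \<tau> * 2 < (N + 1) * \<tau> * (N * \<tau>)"
      unfolding eq by (simp add: field_simps power2_eq_square)
    hence lo: "2 < N * \<tau>" using N1 \<tau> by (simp add: mult_less_cancel_left)
    \<comment> \<open>The root equation yields \<open>(N - 1) * \<tau> \<le> 2 < N * \<tau>\<close>,
      whereas \<open>M\<close> satisfies \<open>(M - 1) * \<tau> < 2 \<le> M * \<tau>\<close>. The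
      two can differ only when \<open>M * \<tau> = 2\<close>, and then \<open>N = M + 1\<close>
      leads to the same root.\<close>
    have "(M - 1) * \<tau> < N * \<tau>" using M lo by simp
    hence "M - 1 < N" using \<tau> by simp
    moreover have "(N - 1) * \<tau> \<le> M * \<tau>" using M up by simp
    hence "N - 1 \<le> M" using \<tau> by simp
    ultimately have "\<lfloor>x / \<tau>\<rfloor> = \<lceil>2 / \<tau>\<rceil> \<or> \<lfloor>x / \<tau>\<rfloor> = \<lceil>2 / \<tau>\<rceil> + 1"
      unfolding N_def M_int by linarith
    hence "N = M \<or> N = M + 1" by (auto simp: N_def M_int)
    thus "x = \<kappa>"
    proof
      assume "N = M"
      with eq have "x * (M * \<tau> - 1) = \<kappa> * (M * \<tau> - 1)" unfolding root by simp
      thus ?thesis using M by simp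
    next
      assume NM: "N = M + 1"
      hence M\<tau>: "M * \<tau> = 2" using up M by simp
      have "\<kappa> = \<tau> * (M * \<tau>) * (M + 1) / 2" using root unfolding M\<tau> by (simp add: power2_eq_square field_simps M\<tau>)
      hence k: "\<kappa> = \<tau> + 2" unfolding M\<tau> using M\<tau> by (simp add: algebra_simps)
      have "N * \<tau> - 1 = 1 + \<tau>" using NM M\<tau> by (simp add: algebra_simps)
      hence "x * (1 + \<tau>) = \<tau>\<^sup>2 * N * (N + 1) / 2" using eq by simp
      also have "\<dots> = \<tau> * (M + 1) * (\<tau> * (M + 2)) / 2"
        by (simp add: NM power2_eq_square add.assoc)
      also have "\<dots> = (2 + \<tau>) * (1 + \<tau>)"
      proof -
        have "\<tau> * (M + 1) = 2 + \<tau>" "\<tau> * (M + 2) = 2 * (1 + \<tau>)" using M\<tau> by (simp_all add: algebra_simps)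
        thus ?thesis by simp
      qed
      finally show ?thesis using \<tau> k by (simp add: add.commute)
    qed
  qed
  show thesis using that[of m \<kappa>] m M root lower upper iff unfolding M_def by blast
qed

lemma sum_Pow_power_card:
  fixes x :: "'a::comm_semiring_1"
  assumes "finite K"
  shows "(\<Sum>J\<in>Pow K. x ^ card J) = (1 + x) ^ card K"
  using prod_add[OF assms, of "\<lambda>_. x" "\<lambda>_. 1"] by (simp add: add.commute)

text \<open>Every \<open>J\<close> contributes at most
  \<open>n powr (- 4 / 3) * (1 / k) ^ card J\<close>. The factor \<open>(1 / k) ^ card J\<close> is
  kept so that summing over all \<open>J\<close> costs only
  \<open>(1 + 1 / k) ^ k \<le> exp 1\<close>.\<close>

lemma overlap_sum_le:
  fixes m t k w n :: nat and b \<rho> :: real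
  assumes b: "1 < b" and n: "1 < n" and tm: "0 < t" "0 < m" and k0: "0 < k"
    and L: "L = log b (real n)" and \<rho>: "0 < \<rho>" "\<rho> < 1"
    and k: "m * t \<le> k" "k \<le> (m + 1) * t"
    and c1: "(real m - 1) * real t \<le> 2 * (\<rho> * L)"
    and c2: "real m * (real m - 1) * (real t)\<^sup>2 + 2 * real m * real t * (real k - real m * real t) \<le> 2 * (\<rho> * L) * real k"
    and w: "real n / L ^ 3 \<le> real w"
    and H1: "real k * L ^ 3 \<le> real n powr (1 / 12)"
    and H2: "real k * L ^ 3 \<le> real n powr ((1 - \<rho>) / 2)"
    and H3: "16 / 3 \<le> (1 - \<rho>) * L"
  shows "(\<Sum>J\<in>Pow {..<k}. if 2 \<le> card J then (1 / real w) ^ card J *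
      b ^ card (sep_edges (\<lambda>i. i div t) J) else 0) \<le> exp 1 * real n powr (- 4 / 3)"
proof -
  have L0: "0 < L" using b n by (simp add: L)
  have nb: "real n = b powr L" using b n by (simp add: L)
  have wpos: "0 < real w" using w L0 n by (smt (verit) divide_pos_pos of_nat_less_iff zero_less_power of_nat_0_less_iff zero_less_one less_trans)
  have w': "1 / real w \<le> L ^ 3 * real n powr (- 1)"
    using w wpos L0 n by (simp add: powr_minus field_simps)
  have n1: "1 \<le> real n" using n by simp
  have summand: "(1 / real w) ^ card J * b ^ card (sep_edges (\<lambda>i. i div t) J)
      \<le> real n powr (- 4 / 3) * (1 / real k) ^ card J"
    if J: "J \<subseteq> {..<k}" "2 \<le> card J" for J
  proof -
    define l where "l = card J"
    define e where "e = card (sep_edges (\<lambda>i. i div t) J)"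
    have finJ: "finite J" using J finite_subset by blast
    have l: "2 \<le> real l" using J by (simp add: l_def)
    have dbl: "real (card (sep_pairs (\<lambda>i. i div t) J)) = 2 * real e"
      using card_sep_pairs[OF finJ, of "\<lambda>i. i div t"] by (simp add: e_def)
    have "real (card (sep_pairs (\<lambda>i. i div t) J)) \<le> 2 * (\<rho> * L) * real (card J)"
      using tm J(1) k L0 \<rho> c1 c2 by (intro card_sep_pairs_div_le[where m = m and k = k]) auto
    hence e1: "real e \<le> \<rho> * L * real l" by (simp add: dbl l_def)
    have "card (sep_pairs (\<lambda>i. i div t) J) \<le> card (J \<times> J)"
      using finJ by (intro card_mono) (auto simp: sep_pairs_def)
    hence "real (card (sep_pairs (\<lambda>i. i div t) J)) \<le> real (l * l)"
      unfolding of_nat_le_iff by (simp add: card_cartesian_product l_def)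
    hence e2: "real e \<le> real l / 2 * real l" by (simp add: dbl)
    \<comment> \<open>An edge density of \<open>a L\<close> per vertex costs \<open>n powr a\<close>
      for each vertex against the gain \<open>1 / n\<close>. The polylogarithmic loss
      \<open>k * L ^ 3\<close> per vertex is absorbed by \<open>n powr h\<close>.\<close>
    have main: "(1 / real w) ^ l * b ^ e \<le> real n powr (- 4 / 3) * (1 / real k) ^ l"
      if e: "real e \<le> a * L * real l" and H: "real k * L ^ 3 \<le> real n powr h"
        and ha: "4 / 3 \<le> (1 - a - h) * real l" for a h
    proof -
      have "b ^ e = b powr real e" using b by (simp add: powr_realpow)
      also have "\<dots> \<le> b powr (a * L * real l)" using b e by (intro powr_mono) auto
      also have "\<dots> = (real n powr a) ^ l"
        unfolding nb by (simp add: powr_powr powr_realpow[symmetric] b order_less_imp_not_eq2 mult_ac)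
          (use b in \<open>simp add: powr_power mult_ac\<close>)
      finally have "(1 / real w) ^ l * b ^ e \<le> (L ^ 3 * real n powr (- 1)) ^ l * (real n powr a) ^ l"
        using w' wpos b L0 by (intro mult_mono power_mono) auto
      also have "\<dots> = (real k * L ^ 3) ^ l * (real n powr (a - 1)) ^ l * (1 / real k) ^ l"
        using k0 n1 by (simp add: power_mult_distrib[symmetric] powr_diff mult_ac)
      also have "\<dots> \<le> (real n powr h) ^ l * (real n powr (a - 1)) ^ l * (1 / real k) ^ l"
        using H L0 by (intro mult_right_mono power_mono) auto
      also have "(real n powr h) ^ l * (real n powr (a - 1)) ^ l = real n powr ((h + a - 1) * real l)"
        using n1 by (simp add: power_mult_distrib[symmetric] powr_add[symmetric] powr_power algebra_simps)
      also have "\<dots> \<le> real n powr (- 4 / 3)"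
        using n1 ha by (intro powr_mono) (auto simp: algebra_simps)
      finally show ?thesis by (simp add: mult_right_mono)
    qed
    \<comment> \<open>For \<open>l \<le> L / 2\<close> the trivial edge bound gives
      \<open>a = 1 / 4\<close>, and \<open>h = 1 / 12\<close> leaves \<open>2 / 3\<close> per
      vertex, which is \<open>4 / 3\<close> already at \<open>l = 2\<close>. For larger
      \<open>l\<close> balancedness gives \<open>a = \<rho>\<close>; half of
      \<open>1 - \<rho>\<close> goes to \<open>h\<close>, and the other half times
      \<open>l > L / 2\<close> exceeds \<open>4 / 3\<close> by \<open>H3\<close>.\<close>
    have "(1 / real w) ^ l * b ^ e \<le> real n powr (- 4 / 3) * (1 / real k) ^ l"
    proof (cases "real l \<le> L / 2")
      case True
      have "real l / 2 * real l \<le> 1 / 4 * L * real l" using True by (intro mult_right_mono) auto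
      with e2 have "real e \<le> 1 / 4 * L * real l" by (rule order_trans)
      thus ?thesis using H1 l by (intro main[of "1/4" "1/12"]) simp_all
    next
      case False
      have "(1 - \<rho>) / 2 * (L / 2) \<le> (1 - \<rho>) / 2 * real l"
        using False \<rho> by (intro mult_left_mono) auto
      hence "4 / 3 \<le> (1 - \<rho> - (1 - \<rho>) / 2) * real l" using H3 by (simp add: field_simps)
      thus ?thesis using e1 H2 by (intro main) auto
    qed
    thus ?thesis by (simp add: l_def e_def)
  qed
  have "(\<Sum>J\<in>Pow {..<k}. if 2 \<le> card J then (1 / real w) ^ card J *
      b ^ card (sep_edges (\<lambda>i. i div t) J) else 0)
    \<le> (\<Sum>J\<in>Pow {..<k}. real n powr (- 4 / 3) * (1 / real k) ^ card J)"
    using summand by (intro sum_mono) auto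
  also have "\<dots> = real n powr (- 4 / 3) * (1 + 1 / real k) ^ k"
    by (simp only: sum_distrib_left[symmetric] sum_Pow_power_card[OF finite_lessThan] card_lessThan)
  also have "\<dots> \<le> real n powr (- 4 / 3) * exp 1"
  proof (intro mult_left_mono)
    have "(1 + 1 / real k) ^ k \<le> exp (1 / real k) ^ k"
      by (intro power_mono exp_ge_add_one_self) auto
    also have "\<dots> = exp 1" using k0 by (simp add: exp_of_nat_mult[symmetric])
    finally show "(1 + 1 / real k) ^ k \<le> exp 1" .
  qed auto
  finally show ?thesis by (simp add: mult.commute)
qed

section \<open>Limits of rounded quantities and rules for a.a.s. statements\<close>

lemma nat_ceiling_over_tendsto:
  fixes f :: "nat \<Rightarrow> real"
  assumes "filterlim f at_top at_top" "0 < a"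
  shows "(\<lambda>n. real (nat \<lceil>a * f n\<rceil>) / f n) \<longlonglongrightarrow> a"
proof (rule real_tendsto_sandwich)
  have ev: "\<forall>\<^sub>F n in at_top. 0 < f n" using assms(1) by (simp add: filterlim_at_top_dense)
  show "\<forall>\<^sub>F n in at_top. a \<le> real (nat \<lceil>a * f n\<rceil>) / f n"
    using ev by eventually_elim (simp add: field_simps, linarith)
  show "\<forall>\<^sub>F n in at_top. real (nat \<lceil>a * f n\<rceil>) / f n \<le> a + 1 / f n"
  proof (use ev in eventually_elim)
    case (elim n)
    have "0 \<le> a * f n" using elim assms by simp
    hence "real (nat \<lceil>a * f n\<rceil>) \<le> a * f n + 1" by linarith
    thus ?case using elim by (simp add: field_simps)
  qed
  have "(\<lambda>n. a + 1 / f n) \<longlonglongrightarrow> a + 0"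
    by (intro tendsto_add tendsto_const tendsto_divide_0[OF tendsto_const] filterlim_at_top_imp_at_infinity assms)
  thus "(\<lambda>n. a + 1 / f n) \<longlonglongrightarrow> a" by simp
qed auto

lemma prob_pmf_not:
  "measure_pmf.prob M {x. \<not> P x} = 1 - measure_pmf.prob M {x. P x}"
  using measure_pmf.prob_compl[of "{x. P x}" M] by (simp add: Compl_eq_Diff_UNIV[symmetric] Collect_neg_eq)

lemma aas_if_complement_small:
  assumes "\<forall>\<^sub>F n in at_top. measure_pmf.prob (X n) {x. \<not> P n x} \<le> e n" "e \<longlonglongrightarrow> 0"
  shows "aas X P"
  unfolding aas_def
proof (rule real_tendsto_sandwich)
  show "\<forall>\<^sub>F n in at_top. 1 - e n \<le> measure_pmf.prob (X n) {x. P n x}"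
    using assms(1) by eventually_elim (simp add: prob_pmf_not)
  show "\<forall>\<^sub>F n in at_top. measure_pmf.prob (X n) {x. P n x} \<le> 1"
    by simp
  show "(\<lambda>n. 1 - e n) \<longlonglongrightarrow> 1" using tendsto_diff[OF tendsto_const assms(2), of 1] by simp
qed auto

lemma aas_conj:
  assumes "aas X P" "aas X Q"
  shows "aas X (\<lambda>n x. P n x \<and> Q n x)"
proof (rule aas_if_complement_small)
  define e where "e n = (1 - measure_pmf.prob (X n) {x. P n x}) + (1 - measure_pmf.prob (X n) {x. Q n x})" for n
  have "measure_pmf.prob (X n) {x. \<not> (P n x \<and> Q n x)} \<le> e n" for n
  proof -
    have "measure_pmf.prob (X n) ({x. \<not> P n x} \<union> {x. \<not> Q n x}) \<le> e n"
      unfolding e_def prob_pmf_not[symmetric] by (rule measure_Un_le) auto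
    moreover have "{x. \<not> (P n x \<and> Q n x)} = {x. \<not> P n x} \<union> {x. \<not> Q n x}" by auto
    ultimately show ?thesis by simp
  qed
  thus "\<forall>\<^sub>F n in at_top. measure_pmf.prob (X n) {x. \<not> (P n x \<and> Q n x)} \<le> e n" by simp
  have "e \<longlonglongrightarrow> (1 - 1) + (1 - 1)" unfolding e_def[abs_def]
    using assms unfolding aas_def by (intro tendsto_intros)
  thus "e \<longlonglongrightarrow> 0" by simp
qed

lemma aas_mono:
  assumes "aas X P" "\<forall>\<^sub>F n in at_top. \<forall>x. P n x \<longrightarrow> Q n x"
  shows "aas X Q"
proof (rule aas_if_complement_small)
  show "\<forall>\<^sub>F n in at_top. measure_pmf.prob (X n) {x. \<not> Q n x} \<le> 1 - measure_pmf.prob (X n) {x. P n x}"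
    using assms(2) unfolding prob_pmf_not[symmetric]
    by eventually_elim (auto intro!: measure_pmf.finite_measure_mono)
  show "(\<lambda>n. 1 - measure_pmf.prob (X n) {x. P n x}) \<longlonglongrightarrow> 0"
    using tendsto_diff[OF tendsto_const assms(1)[unfolded aas_def], of 1] by simp
qed

section \<open>Asymptotics\<close>

lemma filterlim_log_real_at_top:
  assumes "1 < b"
  shows "filterlim (\<lambda>n. log b (real n)) at_top at_top"
proof -
  have "filterlim (\<lambda>n. 1 / ln b * ln (real n)) at_top at_top"
    using assms by (intro filterlim_tendsto_pos_mult_at_top[OF tendsto_const]
      filterlim_compose[OF ln_at_top filterlim_real_sequentially]) auto
  thus ?thesis by (simp add: log_def)
qed

lemma log_power_over_powr_tendsto:
  assumes "1 < b" "0 < h"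
  shows "(\<lambda>n. a * log b (real n) ^ j / real n powr h) \<longlonglongrightarrow> 0"
proof -
  have "(\<lambda>n. (a / ln b ^ j) * (ln (real n) ^ j / real n powr h)) \<longlonglongrightarrow> (a / ln b ^ j) * 0"
    using assms by (intro tendsto_mult tendsto_const) real_asymp
  thus ?thesis by (simp add: log_def power_divide)
qed

text \<open>With \<open>k\<close> of order at most \<open>L\<close>, this makes the number
  \<open>k ^ k\<close> of labellings equal to \<open>b\<close> raised to an exponent of lower order
  than \<open>(L n)\<^sup>2\<close>, so it does not move the threshold.\<close>

lemma log_log_over_log_tendsto:
  assumes "1 < b" "filterlim L at_top at_top" "0 < a"
    and "\<forall>\<^sub>F n in at_top. 1 \<le> k n \<and> k n \<le> a * L n"
  shows "(\<lambda>n::nat. log b (k n) / L n) \<longlonglongrightarrow> 0"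
proof (rule real_tendsto_sandwich)
  have ev: "\<forall>\<^sub>F n in at_top. 0 < L n" using assms(2) by (simp add: filterlim_at_top_dense)
  show "\<forall>\<^sub>F n in at_top. 0 \<le> log b (k n) / L n"
    using ev assms(4) by eventually_elim (use assms(1) in simp)
  show "\<forall>\<^sub>F n in at_top. log b (k n) / L n \<le> log b (a * L n) / L n"
    using ev assms(4) by eventually_elim (use assms(1) in \<open>simp add: divide_right_mono\<close>)
  have "((\<lambda>x. ln (a * x) / x) \<longlongrightarrow> 0) at_top" using assms(3) by real_asymp
  from filterlim_compose[OF this assms(2)]
  have "(\<lambda>n. 1 / ln b * (ln (a * L n) / L n)) \<longlonglongrightarrow> 1 / ln b * 0" by (intro tendsto_mult tendsto_const)
  thus "(\<lambda>n. log b (a * L n) / L n) \<longlonglongrightarrow> 0" by (simp add: log_def)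
qed auto

lemma sverts_erdos_renyi: "G \<in> set_pmf (erdos_renyi n p) \<Longrightarrow> sverts G = {1..n}"
  by (auto simp: erdos_renyi_def)

text \<open>The events range over all graphs of the type, while the vertex set is known to be
  \<open>{1..n}\<close> only on the support of the distribution. The implication is therefore
  demanded only there.\<close>

lemma prob_erdos_renyi_mono:
  assumes "\<And>G. sverts G = {1..n} \<Longrightarrow> P G \<Longrightarrow> Q G"
  shows "measure_pmf.prob (erdos_renyi n p) {G. P G} \<le> measure_pmf.prob (erdos_renyi n p) {G. Q G}"
  by (rule measure_pmf.finite_measure_mono_AE)
    (auto simp: AE_measure_pmf_iff intro!: assms sverts_erdos_renyi)

lemma chromatic_number_lower_aas:
  fixes p b \<tau> \<kappa> c :: real and t :: "nat \<Rightarrow> nat" and m :: nat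
  assumes p: "0 < p" "p < 1" and b: "b = 1 / (1 - p)" and t: "\<And>n. 0 < t n"
    and tL: "(\<lambda>n. real (t n) / log b (real n)) \<longlonglongrightarrow> \<tau>"
    and m: "2 \<le> real m * \<tau>" "\<kappa> * (real m * \<tau> - 1) = \<tau>\<^sup>2 * real m * (real m + 1) / 2"
    and \<kappa>: "0 < \<kappa>" "\<kappa> < c"
  shows "aas (\<lambda>n. erdos_renyi n p)
    (\<lambda>n G. real n / (c * log b (real n)) \<le> real (t_component_chromatic_number (t n) G))"
proof -
  define L where "L n = log b (real n)" for n
  \<comment> \<open>Strictly between \<open>\<kappa>\<close> and \<open>c\<close>: above
    \<open>\<kappa>\<close> the first moment vanishes, and below \<open>c\<close> rounding up still
    leaves \<open>k n \<le> c * L n\<close> eventually.\<close>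
  define a where "a = (\<kappa> + c) / 2"
  define k where "k n = nat \<lceil>a * L n\<rceil>" for n
  define g where "g n = real m * real (t n) * real (k n) - (real (t n))\<^sup>2 * real m * (real m + 1) / 2" for n
  have b1: "1 < b" using p by (simp add: b)
  have a: "0 < a" "\<kappa> < a" "a < c" using \<kappa> by (simp_all add: a_def)
  have L_top: "filterlim L at_top at_top" unfolding L_def[abs_def] by (rule filterlim_log_real_at_top[OF b1])
  have L_pos: "\<forall>\<^sub>F n in at_top. 0 < L n" using L_top by (simp add: filterlim_at_top_dense)
  have kL: "(\<lambda>n. real (k n) / L n) \<longlonglongrightarrow> a"
    unfolding k_def using nat_ceiling_over_tendsto[OF L_top a(1)] .
  have k_le: "\<forall>\<^sub>F n in at_top. real (k n) \<le> c * L n"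
    using order_tendstoD(2)[OF kL a(3)] L_pos by eventually_elim (simp add: field_simps)
  have k_ge: "\<forall>\<^sub>F n in at_top. 1 \<le> real (k n)"
    using L_pos
  proof eventually_elim
    case (elim n)
    have "0 < a * L n" using elim a by simp
    hence "0 < k n" by (simp add: k_def)
    thus ?case by simp
  qed
  have logk: "(\<lambda>n. log b (real (k n)) / L n) \<longlonglongrightarrow> 0"
    using k_le k_ge a \<kappa> by (intro log_log_over_log_tendsto[OF b1 L_top, of c]) (auto elim: eventually_elim2)
  \<comment> \<open>Limit of the first-moment exponent divided by \<open>(L n)\<^sup>2\<close>; the
    summand \<open>a * 0\<close> is the contribution of the labellings. Negativity is precisely
    \<open>a > \<kappa>\<close>, by the root equation.\<close>
  define \<beta> where "\<beta> = a + a * 0 - (real m * \<tau> * a - \<tau>\<^sup>2 * real m * (real m + 1) / 2)"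
  have lim: "(\<lambda>n. real (k n) / L n + real (k n) / L n * (log b (real (k n)) / L n)
      - (real m * (real (t n) / L n) * (real (k n) / L n) - (real (t n) / L n)\<^sup>2 * real m * (real m + 1) / 2)) \<longlonglongrightarrow> \<beta>"
    unfolding \<beta>_def using tL by (intro tendsto_intros kL logk) (simp_all add: L_def)
  have "\<beta> < 0"
  proof -
    have "\<kappa> * (real m * \<tau> - 1) < a * (real m * \<tau> - 1)"
      using a m by (intro mult_strict_right_mono) auto
    thus ?thesis unfolding m(2) \<beta>_def by (simp add: algebra_simps)
  qed
  define e where "e n = b powr (real (k n) * L n + real (k n) * log b (real (k n)) - g n)" for n
  have "filterlim (\<lambda>n. (L n)\<^sup>2 * (real (k n) / L n + real (k n) / L n * (log b (real (k n)) / L n)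
      - (real m * (real (t n) / L n) * (real (k n) / L n) - (real (t n) / L n)\<^sup>2 * real m * (real m + 1) / 2)))
      at_bot at_top"
    by (subst mult.commute, rule filterlim_tendsto_neg_mult_at_bot[OF lim \<open>\<beta> < 0\<close>])
      (intro filterlim_pow_at_top L_top, simp)
  hence "filterlim (\<lambda>n. real (k n) * L n + real (k n) * log b (real (k n)) - g n) at_bot at_top"
  proof (rule filterlim_mono_eventually[OF _ order_refl order_refl])
    show "\<forall>\<^sub>F n in at_top. (L n)\<^sup>2 * (real (k n) / L n + real (k n) / L n * (log b (real (k n)) / L n)
      - (real m * (real (t n) / L n) * (real (k n) / L n) - (real (t n) / L n)\<^sup>2 * real m * (real m + 1) / 2))
      = real (k n) * L n + real (k n) * log b (real (k n)) - g n"
      using L_pos by eventually_elim (simp add: g_def field_simps power2_eq_square)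
  qed
  hence e0: "e \<longlonglongrightarrow> 0"
  proof -
    assume lim: "filterlim (\<lambda>n. real (k n) * L n + real (k n) * log b (real (k n)) - g n) at_bot at_top"
    have "filterlim (\<lambda>n. ln b * (real (k n) * L n + real (k n) * log b (real (k n)) - g n)) at_bot at_top"
      using b1 by (intro filterlim_tendsto_pos_mult_at_bot[OF tendsto_const _ lim]) auto
    from filterlim_compose[OF exp_at_bot this] show ?thesis
      unfolding e_def[abs_def] using b1 by (simp add: powr_def mult.commute)
  qed
  show ?thesis
  proof (rule aas_if_complement_small[OF _ e0])
    show "\<forall>\<^sub>F n in at_top. measure_pmf.prob (erdos_renyi n p)
        {G. \<not> real n / (c * log b (real n)) \<le> real (t_component_chromatic_number (t n) G)} \<le> e n"
      using k_le k_ge L_pos eventually_gt_at_top[of 1]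
    proof eventually_elim
      case (elim n)
      have "measure_pmf.prob (erdos_renyi n p)
          {G. \<not> real n / (c * log b (real n)) \<le> real (t_component_chromatic_number (t n) G)}
        \<le> measure_pmf.prob (erdos_renyi n p) {G. \<exists>T. t_component_set (t n) G T \<and> card T = k n}"
      proof (rule prob_erdos_renyi_mono, rule ccontr)
        fix G :: "nat sgraph"
        assume G: "sverts G = {1..n}"
          and less: "\<not> real n / (c * log b (real n)) \<le> real (t_component_chromatic_number (t n) G)"
          and no: "\<not> (\<exists>T. t_component_set (t n) G T \<and> card T = k n)"
        have "card (sverts G) \<le> k n * t_component_chromatic_number (t n) G"
          by (rule chromatic_number_lower[OF t]) (use G no in auto)
        hence "real n \<le> real (k n * t_component_chromatic_number (t n) G)"
          unfolding of_nat_le_iff using G by simp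
        also have "\<dots> = real (k n) * real (t_component_chromatic_number (t n) G)" by simp
        also have "\<dots> \<le> c * L n * real (t_component_chromatic_number (t n) G)"
          using elim by (intro mult_right_mono) auto
        finally show False using less elim \<kappa> by (simp add: L_def field_simps)
      qed
      also have "\<dots> \<le> real n ^ k n * real (k n) ^ k n * (1 - p) powr g n"
        by (rule prob_large_component_set_le[OF p]) (simp add: g_def)
      also have "real n ^ k n = b powr (real (k n) * L n)"
        using elim b1 by (simp add: L_def powr_powr[symmetric] mult.commute[of "real (k n)"] powr_realpow)
      also have "real (k n) ^ k n = b powr (real (k n) * log b (real (k n)))"
        using elim b1 by (simp add: powr_powr[symmetric] mult.commute[of "real (k n)"] powr_realpow)
      also have "(1 - p) powr g n = b powr (- g n)"
        using p by (simp add: b powr_minus powr_divide)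
      finally show ?case using b1 by (simp add: e_def powr_add[symmetric])
    qed
  qed
qed

lemma chromatic_number_upper_aas:
  fixes p b \<tau> \<kappa> c :: real and t :: "nat \<Rightarrow> nat" and m :: nat
  assumes p: "0 < p" "p < 1" and b: "b = 1 / (1 - p)" and t: "\<And>n. 0 < t n" and \<tau>: "0 < \<tau>"
    and tL: "(\<lambda>n. real (t n) / log b (real n)) \<longlonglongrightarrow> \<tau>"
    and m: "0 < m" "(real m - 1) * \<tau> < 2" "2 \<le> real m * \<tau>"
      "\<kappa> * (real m * \<tau> - 1) = \<tau>\<^sup>2 * real m * (real m + 1) / 2"
      "real m * \<tau> < \<kappa>" "\<kappa> \<le> (real m + 1) * \<tau>"
    and c: "0 < c" "c < \<kappa>"
  shows "aas (\<lambda>n. erdos_renyi n p)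
    (\<lambda>n G. real (t_component_chromatic_number (t n) G) \<le> real n / (c * log b (real n)))"
proof -
  define L where "L n = log b (real n)" for n
  \<comment> \<open>Below \<open>\<kappa>\<close> for balancedness, above \<open>m \<tau>\<close> so
    that \<open>k n\<close> eventually lies between \<open>m * t n\<close> and
    \<open>(m + 1) * t n\<close>, and above \<open>c\<close> to leave room for the colours of the
    leftover vertices.\<close>
  obtain a where a: "max c (real m * \<tau>) < a" "a < \<kappa>" using c m dense[of "max c (real m * \<tau>)" \<kappa>] by auto
  hence a0: "0 < a" "c < a" "real m * \<tau> < a" using c by auto
  define k where "k n = nat \<lceil>a * L n\<rceil>" for n
  \<comment> \<open>With this pool size the leftover colours number about \<open>k * w\<close>, of
    order \<open>n / L ^ 2\<close> and hence negligible against \<open>n / L\<close>, while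
    \<open>w\<close> falls short of \<open>n\<close> only by a power of \<open>L\<close>. The factor
    1 matches the form of \<open>nat_ceiling_over_tendsto\<close>.\<close>
  define w where "w n = nat \<lceil>1 * (real n / L n ^ 3)\<rceil>" for n
  have b1: "1 < b" using p by (simp add: b)
  have L_top: "filterlim L at_top at_top" unfolding L_def[abs_def] by (rule filterlim_log_real_at_top[OF b1])
  have L_pos: "\<forall>\<^sub>F n in at_top. 0 < L n" using L_top by (simp add: filterlim_at_top_dense)
  have tL': "(\<lambda>n. real (t n) / L n) \<longlonglongrightarrow> \<tau>" using tL by (simp add: L_def)
  have kL: "(\<lambda>n. real (k n) / L n) \<longlonglongrightarrow> a"
    unfolding k_def using nat_ceiling_over_tendsto[OF L_top a0(1)] .
  have nL: "filterlim (\<lambda>n. real n / L n ^ 3) at_top at_top"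
  proof -
    have "(\<lambda>n. inverse (real n / L n ^ 3)) \<longlonglongrightarrow> 0"
      using log_power_over_powr_tendsto[OF b1, of 1 1 3]
      by (rule Lim_transform_eventually) (auto simp: L_def field_simps intro: eventually_mono[OF eventually_gt_at_top[of 0]])
    moreover have "\<forall>\<^sub>F n in at_top. 0 < inverse (real n / L n ^ 3)"
      using L_pos eventually_gt_at_top[of 0] by eventually_elim simp
    ultimately have "filterlim (\<lambda>n. inverse (inverse (real n / L n ^ 3))) at_top at_top"
      by (rule filterlim_inverse_at_top)
    thus ?thesis by simp
  qed
  have wn: "(\<lambda>n. real (w n) / (real n / L n ^ 3)) \<longlonglongrightarrow> 1"
    unfolding w_def by (rule nat_ceiling_over_tendsto[OF nL]) simp
  \<comment> \<open>Limits of edges per vertex, divided by \<open>L\<close>, for the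
    \<open>m\<close> full blocks (\<open>r1\<close>) and for the whole pattern (\<open>r2\<close>).
    Here \<open>r2\<close> is \<open>f(a) / a\<close>, so \<open>r2 < 1\<close> expresses
    \<open>a < \<kappa>\<close>.\<close>
  define r1 where "r1 = (real m - 1) * \<tau> / 2"
  define r2 where "r2 = (real m * (real m - 1) * \<tau>\<^sup>2 + 2 * real m * \<tau> * (a - real m * \<tau>)) / (2 * a)"
  have "r1 < 1" using m by (simp add: r1_def)
  moreover have "r2 < 1"
  proof -
    have "a * (real m * \<tau> - 1) < \<kappa> * (real m * \<tau> - 1)"
      using a m by (intro mult_strict_right_mono) auto
    thus ?thesis unfolding m(4) r2_def using a0 by (simp add: field_simps power2_eq_square)
  qed
  ultimately obtain \<rho> where \<rho>: "max 0 (max r1 r2) < \<rho>" "\<rho> < 1"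
    using dense[of "max 0 (max r1 r2)" 1] by auto
  have ev1: "\<forall>\<^sub>F n in at_top. (real m - 1) * real (t n) \<le> 2 * (\<rho> * L n)"
  proof -
    have "(\<lambda>n. (real m - 1) * (real (t n) / L n) / 2) \<longlonglongrightarrow> r1"
      unfolding r1_def by (intro tendsto_intros tL') auto
    from order_tendstoD(2)[OF this, of \<rho>] \<rho>
    have "\<forall>\<^sub>F n in at_top. (real m - 1) * (real (t n) / L n) / 2 < \<rho>" by simp
    thus ?thesis using L_pos by eventually_elim (simp add: field_simps)
  qed
  have ev2: "\<forall>\<^sub>F n in at_top. real m * (real m - 1) * (real (t n))\<^sup>2
      + 2 * real m * real (t n) * (real (k n) - real m * real (t n)) \<le> 2 * (\<rho> * L n) * real (k n)"
  proof -
    have lim: "(\<lambda>n. real m * (real m - 1) * (real (t n) / L n)\<^sup>2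
      + 2 * real m * (real (t n) / L n) * (real (k n) / L n - real m * (real (t n) / L n)) - 2 * \<rho> * (real (k n) / L n))
      \<longlonglongrightarrow> real m * (real m - 1) * \<tau>\<^sup>2 + 2 * real m * \<tau> * (a - real m * \<tau>) - 2 * \<rho> * a"
      by (intro tendsto_intros tL' kL)
    have "real m * (real m - 1) * \<tau>\<^sup>2 + 2 * real m * \<tau> * (a - real m * \<tau>) - 2 * \<rho> * a < 0"
      using \<rho> a0 by (simp add: r2_def field_simps)
    from order_tendstoD(2)[OF lim this] L_pos show ?thesis
    proof eventually_elim
      case (elim n)
      have "(L n)\<^sup>2 * (real m * (real m - 1) * (real (t n) / L n)\<^sup>2
        + 2 * real m * (real (t n) / L n) * (real (k n) / L n - real m * (real (t n) / L n)) - 2 * \<rho> * (real (k n) / L n)) \<le> 0"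
        using elim by (intro mult_nonneg_nonpos) auto
      also have "(L n)\<^sup>2 * (real m * (real m - 1) * (real (t n) / L n)\<^sup>2
        + 2 * real m * (real (t n) / L n) * (real (k n) / L n - real m * (real (t n) / L n)) - 2 * \<rho> * (real (k n) / L n))
        = real m * (real m - 1) * (real (t n))\<^sup>2
      + 2 * real m * real (t n) * (real (k n) - real m * real (t n)) - 2 * (\<rho> * L n) * real (k n)"
        using elim by (simp add: field_simps power2_eq_square)
      finally show ?case by simp
    qed
  qed
  have ev3: "\<forall>\<^sub>F n in at_top. m * t n \<le> k n"
  proof -
    have "(\<lambda>n. real (k n) / L n - real m * (real (t n) / L n)) \<longlonglongrightarrow> a - real m * \<tau>"
      by (intro tendsto_intros tL' kL)
    from order_tendstoD(1)[OF this, of 0] a0 L_pos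
    have "\<forall>\<^sub>F n in at_top. 0 < real (k n) / L n - real m * (real (t n) / L n)" by simp
    thus ?thesis using L_pos
    proof eventually_elim
      case (elim n)
      hence "real (m * t n) \<le> real (k n)" by (simp add: field_simps)
      thus ?case unfolding of_nat_le_iff .
    qed
  qed
  have ev4: "\<forall>\<^sub>F n in at_top. k n \<le> (m + 1) * t n"
  proof -
    have "(\<lambda>n. (real m + 1) * (real (t n) / L n) - real (k n) / L n) \<longlonglongrightarrow> (real m + 1) * \<tau> - a"
      by (intro tendsto_intros tL' kL)
    from order_tendstoD(1)[OF this, of 0] a m(6)
    have "\<forall>\<^sub>F n in at_top. 0 < (real m + 1) * (real (t n) / L n) - real (k n) / L n" by simp
    thus ?thesis using L_pos
    proof eventually_elim
      case (elim n)
      hence "L n * real (k n) \<le> L n * real ((m + 1) * t n)" by (simp add: field_simps)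
      hence "real (k n) \<le> real ((m + 1) * t n)" using elim by (simp only: mult_le_cancel_left_pos)
      thus ?case unfolding of_nat_le_iff .
    qed
  qed
  have k_le: "\<forall>\<^sub>F n in at_top. real (k n) \<le> \<kappa> * L n"
    using order_tendstoD(2)[OF kL a(2)] L_pos by eventually_elim (simp add: field_simps)
  have k_pos: "\<forall>\<^sub>F n in at_top. 0 < k n"
    using L_pos by eventually_elim (use a0 in \<open>simp add: k_def\<close>)
  have polylog: "\<forall>\<^sub>F n in at_top. real (k n) * L n ^ 3 \<le> real n powr h" if h: "0 < h" for h
  proof -
    from order_tendstoD(2)[OF log_power_over_powr_tendsto[OF b1 h, of \<kappa> 4], of 1]
    have "\<forall>\<^sub>F n in at_top. \<kappa> * L n ^ 4 / real n powr h < 1" by (simp add: L_def)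
    thus ?thesis using L_pos k_le eventually_gt_at_top[of 0]
    proof eventually_elim
      case (elim n)
      have "real (k n) * L n ^ 3 \<le> \<kappa> * L n * L n ^ 3" using elim by (intro mult_right_mono) auto
      also have "\<dots> = \<kappa> * L n ^ 4" by (simp add: numeral_eq_Suc)
      also have "\<dots> \<le> real n powr h" using elim by (simp add: field_simps)
      finally show ?case .
    qed
  qed
  have ev5: "\<forall>\<^sub>F n in at_top. 16 / 3 \<le> (1 - \<rho>) * L n"
  proof -
    have "filterlim (\<lambda>n. (1 - \<rho>) * L n) at_top at_top"
      using \<rho> by (intro filterlim_tendsto_pos_mult_at_top[OF tendsto_const _ L_top]) auto
    thus ?thesis unfolding filterlim_at_top by blast
  qed
  \<comment> \<open>Total number of colours: \<open>n / k\<close> greedy classes and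
    \<open>k * w\<close> leftovers. Divided by \<open>n / L\<close> this tends to
    \<open>1 / a\<close>, which is less than \<open>1 / c\<close>.\<close>
  have ev6: "\<forall>\<^sub>F n in at_top. real n / real (k n) + real (k n) * real (w n) \<le> real n / (c * L n)"
  proof -
    have "(\<lambda>n. 1 / (real (k n) / L n) + (real (k n) / L n) * (real (w n) / (real n / L n ^ 3)) * (1 / L n))
      \<longlonglongrightarrow> 1 / a + a * 1 * 0"
      by (intro tendsto_intros kL wn tendsto_divide_0[OF tendsto_const] filterlim_at_top_imp_at_infinity L_top)
        (use a0 in auto)
    from order_tendstoD(2)[OF this, of "1 / c"] a0 c
    have "\<forall>\<^sub>F n in at_top. 1 / (real (k n) / L n) + (real (k n) / L n) * (real (w n) / (real n / L n ^ 3)) * (1 / L n) < 1 / c"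
      by (simp add: field_simps)
    thus ?thesis using L_pos k_pos eventually_gt_at_top[of 0]
    proof eventually_elim
      case (elim n)
      have "real n / L n * (1 / (real (k n) / L n) + (real (k n) / L n) * (real (w n) / (real n / L n ^ 3)) * (1 / L n))
          \<le> real n / L n * (1 / c)"
        using elim by (intro mult_left_mono) auto
      also have "real n / L n * (1 / (real (k n) / L n) + (real (k n) / L n) * (real (w n) / (real n / L n ^ 3)) * (1 / L n))
        = real n / real (k n) + real (k n) * real (w n)"
        using elim by (simp add: field_simps numeral_eq_Suc)
      finally show ?case by (simp add: mult.commute)
    qed
  qed
  define D where "D n = exp 1 * real n powr (- 4 / 3)" for n
  define e where "e n = 2 ^ n * exp (- 1 / (2 * D n))" for n
  \<comment> \<open>The exponent \<open>1 / (2 * D n)\<close> grows like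
    \<open>n powr (4 / 3)\<close>, faster than \<open>n * ln 2\<close>.\<close>
  have e0: "e \<longlonglongrightarrow> 0" unfolding e_def[abs_def] D_def by real_asymp
  show ?thesis
  proof (rule aas_if_complement_small[OF _ e0])
    have h: "0 < (1 - \<rho>) / 2" using \<rho> by simp
    show "\<forall>\<^sub>F n in at_top. measure_pmf.prob (erdos_renyi n p)
        {G. \<not> real (t_component_chromatic_number (t n) G) \<le> real n / (c * log b (real n))} \<le> e n"
      using ev1 ev2 ev3 ev4 ev5 ev6 k_pos L_pos polylog[OF h] polylog[of "1 / 12", simplified]
        eventually_gt_at_top[of 1]
    proof eventually_elim
      case (elim n)
      have w_ge: "real n / L n ^ 3 \<le> real (w n)" unfolding w_def by linarith
      moreover have "0 < real n / L n ^ 3" using elim by simp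
      ultimately have w0: "0 < w n" by (metis of_nat_0_less_iff less_le_trans)
      have "(\<Sum>J\<in>Pow {..<k n}. if 2 \<le> card J then (1 / real (w n)) ^ card J *
        b ^ card (sep_edges (\<lambda>i. i div t n) J) else 0) \<le> D n"
        unfolding D_def
        by (rule overlap_sum_le[where L = "L n" and m = m and \<rho> = \<rho>])
          (use b1 elim t m \<rho> w_ge in \<open>auto simp: L_def\<close>)
      hence D: "(\<Sum>J\<in>Pow {..<k n}. if 2 \<le> card J then (1 / real (w n)) ^ card J *
        (1 / (1 - p)) ^ card (sep_edges (\<lambda>i. i div t n) J) else 0) \<le> D n" unfolding b .
      have "measure_pmf.prob (erdos_renyi n p)
          {G. \<not> real (t_component_chromatic_number (t n) G) \<le> real n / (c * log b (real n))}
        \<le> measure_pmf.prob (erdos_renyi n p)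
          {G. \<not> k n * t_component_chromatic_number (t n) G \<le> n + k n * (k n * w n)}"
      proof (rule prob_erdos_renyi_mono, rule notI)
        fix G :: "nat sgraph"
        let ?x = "t_component_chromatic_number (t n) G"
        assume less: "\<not> real ?x \<le> real n / (c * log b (real n))"
          and "k n * ?x \<le> n + k n * (k n * w n)"
        hence "real (k n * ?x) \<le> real (n + k n * (k n * w n))" by (intro of_nat_mono)
        hence "real (k n) * real ?x \<le> real n + real (k n) * (real (k n) * real (w n))" by simp
        hence "real ?x \<le> real n / real (k n) + real (k n) * real (w n)"
          using elim by (simp add: field_simps)
        also have "\<dots> \<le> real n / (c * L n)" using elim by simp
        finally show False using less by (simp add: L_def)
      qed
      also have "\<dots> \<le> 2 ^ n * exp (- 1 / (2 * D n))"
        by (rule prob_chromatic_number_large_le[OF p t w0 _ _ D]) (use elim in \<open>auto simp: D_def\<close>)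
      finally show ?case by (simp add: e_def)
    qed
  qed
qed

theorem theorem1p2:
  fixes p b \<tau> :: real and t :: "nat \<Rightarrow> nat"
  assumes "0 < p" and "p < 1" and "b = 1 / (1 - p)"
    and "\<And>n. 0 < t n" and "0 < \<tau>"
    and "(\<lambda>n. real (t n)) \<sim>[at_top] (\<lambda>n. \<tau> * log b (real n))"
  shows "(\<exists>!\<kappa>. 0 < \<kappa> \<and> iota \<tau> \<kappa> = 0) \<and>
    (\<forall>\<kappa>. 0 < \<kappa> \<and> iota \<tau> \<kappa> = 0 \<longrightarrow>
      aas_asymp_equiv (\<lambda>n. erdos_renyi n p)
        (\<lambda>n G. real (t_component_chromatic_number (t n) G))
        (\<lambda>n. real n / (\<kappa> * log b (real n))))"
proof -
  obtain m :: nat and \<kappa> :: real where m: "0 < m" "(real m - 1) * \<tau> < 2" "2 \<le> real m * \<tau>"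
      "\<kappa> * (real m * \<tau> - 1) = \<tau>\<^sup>2 * real m * (real m + 1) / 2"
      "real m * \<tau> < \<kappa>" "\<kappa> \<le> (real m + 1) * \<tau>"
    and root: "\<And>x. 0 < x \<and> iota \<tau> x = 0 \<longleftrightarrow> x = \<kappa>"
    using iota_positive_root[OF assms(5)] by blast
  have \<kappa>: "0 < \<kappa>" using root by blast
  have b1: "1 < b" using assms(1-3) by simp
  have L_pos: "\<forall>\<^sub>F n in at_top. 0 < log b (real n)"
    using filterlim_log_real_at_top[OF b1] by (simp add: filterlim_at_top_dense)
  \<comment> \<open>Asymptotic equivalence treats the quotient 0 / 0 as 1; positivity of
    \<open>t n\<close> rules that case out, so the quotient itself converges.\<close>
  have "(\<lambda>n. real (t n) / (\<tau> * log b (real n))) \<longlonglongrightarrow> 1"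
    by (rule asymp_equivD_strong[OF assms(6)]) (use assms(4) in \<open>auto simp: always_eventually\<close>)
  from tendsto_mult_left[OF this, of \<tau>]
  have tL: "(\<lambda>n. real (t n) / log b (real n)) \<longlonglongrightarrow> \<tau>" using assms(5) by simp
  have "aas_asymp_equiv (\<lambda>n. erdos_renyi n p) (\<lambda>n G. real (t_component_chromatic_number (t n) G))
        (\<lambda>n. real n / (\<kappa> * log b (real n)))"
    unfolding aas_asymp_equiv_def
  proof (intro allI impI)
    fix \<epsilon> :: real assume \<epsilon>: "0 < \<epsilon>"
    \<comment> \<open>Dividing and multiplying by \<open>1 + \<epsilon>\<close> works for every
      positive \<open>\<epsilon>\<close>. The smaller constant gives the upper bound
      \<open>(1 + \<epsilon>) y\<close> exactly, and the larger one gives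
      \<open>y / (1 + \<epsilon>)\<close>, which is at least
      \<open>(1 - \<epsilon>) y\<close>.\<close>
    have "\<kappa> / (1 + \<epsilon>) < \<kappa>" "\<kappa> < \<kappa> * (1 + \<epsilon>)" "0 < \<kappa> / (1 + \<epsilon>)"
      using \<kappa> \<epsilon> by (simp_all add: field_simps)
    note c = this
    have "aas (\<lambda>n. erdos_renyi n p) (\<lambda>n G.
        real n / ((\<kappa> * (1 + \<epsilon>)) * log b (real n)) \<le> real (t_component_chromatic_number (t n) G) \<and>
        real (t_component_chromatic_number (t n) G) \<le> real n / ((\<kappa> / (1 + \<epsilon>)) * log b (real n)))"
      using chromatic_number_lower_aas[OF assms(1-4) tL m(3,4) \<kappa> c(2)]
        chromatic_number_upper_aas[OF assms(1-5) tL m c(3,1)] by (rule aas_conj)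
    thus "aas (\<lambda>n. erdos_renyi n p) (\<lambda>n G.
      \<bar>real (t_component_chromatic_number (t n) G) - real n / (\<kappa> * log b (real n))\<bar>
        \<le> \<epsilon> * \<bar>real n / (\<kappa> * log b (real n))\<bar>)"
    proof (rule aas_mono)
      show "\<forall>\<^sub>F n in at_top. \<forall>G.
        real n / ((\<kappa> * (1 + \<epsilon>)) * log b (real n)) \<le> real (t_component_chromatic_number (t n) G) \<and>
        real (t_component_chromatic_number (t n) G) \<le> real n / ((\<kappa> / (1 + \<epsilon>)) * log b (real n)) \<longrightarrow>
        \<bar>real (t_component_chromatic_number (t n) G) - real n / (\<kappa> * log b (real n))\<bar>
        \<le> \<epsilon> * \<bar>real n / (\<kappa> * log b (real n))\<bar>"
        using L_pos
      proof eventually_elim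
        case (elim n)
        define y where "y = real n / (\<kappa> * log b (real n))"
        have y: "0 \<le> y" using elim \<kappa> by (simp add: y_def)
        have up: "real n / ((\<kappa> / (1 + \<epsilon>)) * log b (real n)) = y + \<epsilon> * y"
          using \<epsilon> by (simp add: y_def field_simps add_divide_distrib)
        have "(1 - \<epsilon>) * (1 + \<epsilon>) \<le> 1" by (simp add: algebra_simps)
        hence "(1 - \<epsilon>) \<le> 1 / (1 + \<epsilon>)" using \<epsilon> by (simp add: field_simps)
        hence "(1 - \<epsilon>) * y \<le> 1 / (1 + \<epsilon>) * y" using y by (rule mult_right_mono)
        also have "\<dots> = real n / ((\<kappa> * (1 + \<epsilon>)) * log b (real n))"
          using \<epsilon> by (simp add: y_def mult_ac)
        finally have lo: "y - \<epsilon> * y \<le> real n / ((\<kappa> * (1 + \<epsilon>)) * log b (real n))"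
          by (simp add: algebra_simps)
        show ?case
          unfolding y_def[symmetric] up using lo y by (auto simp: abs_le_iff)
      qed
    qed
  qed
  moreover have "\<exists>!x. 0 < x \<and> iota \<tau> x = 0" using root by auto
  ultimately show ?thesis using root by auto
qed

end
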